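(* Let $\mathcal G:\mathscr P_2(\mathbb R^d)\to\mathbb R$ be locally Lipschitz around $\mu\in\mathscr P_2(\mathbb R^d)$. Let $\mu_n\to\mu$ in $\mathscr P_2(\mathbb R^d)$, $\Xi_n\in\partial_C\mathcal G(\mu_n)$, and $\gamma_n\in\Gamma(\mu,\mu_n)$ be such that $\|\pi^2-\pi^1\|_{\gamma_n}\to0$, and let $\Xi\in L^2_\mu$ be a limit point of the sequence $\{\mathsf P_{\gamma_n}\Xi_n\}_n$ in the weak topology of $L^2_\mu$. Then $\Xi\in\partial_C\mathcal G(\mu)$.
   Context: $\mathscr P_2(\mathbb R^d)$ is the space of Borel probability measures on $\mathbb R^d$ with finite second moment, with the 2-Wasserstein distance $d_{\mathcal W}$; $\Gamma(\mu,\nu)$ is the set of all couplings (not necessarily optimal); $\|\pi^2-\pi^1\|_\gamma^2=\int|y-x|^2d\gamma(x,y)$. $L^2_\mu$ is the space of $\mu$-square-integrable maps $\mathbb R^d\to\mathbb R^d$ with inner product $\langle\cdot,\cdot\rangle_\mu$. Pullback map: for $\gamma\in\Gamma(\mu,\nu)$ with disintegration $\gamma(dx,dy)=\mu(dx)\gamma_x(dy)$, $\mathsf P_\gamma:L^2_\nu\to L^2_\mu$ is $\mathsf P_\gamma\beta(x):=\int\beta(y)\,\gamma_x(dy)$ for $\mu$-a.e. $x$. Clarke subdifferential: let $C_1(\mathbb R^d;\mathbb R^d)$ be the set of continuous maps $w$ with $\sup_x|w(x)|/(1+|x|)<\infty$. For $\mathcal G$ locally Lipschitz around $\mu$ (i.e.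 Lipschitz in a neighborhood of $\mu$), $D\mathcal G(\mu)(w):=\limsup_{\nu\to\mu,\ t\searrow0}\frac{\mathcal G((\mathrm{id}+tw)_\#\nu)-\mathcal G(\nu)}{t}$ and $\partial_C\mathcal G(\mu):=\{\Xi\in L^2_\mu:\ \langle\Xi,w\rangle_\mu\le D\mathcal G(\mu)(w)\ \ \forall w\in C_1(\mathbb R^d;\mathbb R^d)\}$. (For $n$ large, $\mathcal G$ is locally Lipschitz around $\mu_n$, so $\partial_C\mathcal G(\mu_n)$ is defined.) *)

theory Defs
  imports "HOL-Probability.Probability"
begin

text \<open>The ambient space \<open>'a::euclidean_space\<close> plays the role of the Euclidean space of dimension
  \<open>DIM('a)\<close>. Functionals on the Wasserstein space are total functions on \<open>'a measure\<close>; only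
  their values on \<open>P2\<close> are ever used.\<close>

definition P2 :: "'a::euclidean_space measure set" where
  "P2 = {\<mu>. prob_space \<mu> \<and> sets \<mu> = sets borel \<and> integrable \<mu> (\<lambda>x. (norm x)\<^sup>2)}"

definition couplings ::
  "'a::euclidean_space measure \<Rightarrow> 'a measure \<Rightarrow> ('a \<times> 'a) measure set" where
  "couplings \<mu> \<nu> =
     {\<gamma>. prob_space \<gamma> \<and> sets \<gamma> = sets borel \<and> distr \<gamma> borel fst = \<mu> \<and> distr \<gamma> borel snd = \<nu>}"

text \<open>The norm of \<open>\<pi>\<^sup>2 - \<pi>\<^sup>1\<close> with respect to \<open>\<gamma>\<close>. The integrand is always integrable when \<open>\<gamma>\<close> couples
  two elements of \<open>P2\<close>.\<close>

definition displacement_norm :: "('a::euclidean_space \<times> 'a) measure \<Rightarrow> real" where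
  "displacement_norm \<gamma> = sqrt (\<integral>z. (norm (snd z - fst z))\<^sup>2 \<partial>\<gamma>)"

definition W2 :: "'a::euclidean_space measure \<Rightarrow> 'a measure \<Rightarrow> real" where
  "W2 \<mu> \<nu> = (INF \<gamma>\<in>couplings \<mu> \<nu>. displacement_norm \<gamma>)"

definition W2_nhds :: "'a::euclidean_space measure \<Rightarrow> 'a measure filter" where
  "W2_nhds \<mu> = (INF r\<in>{0<..}. principal {\<nu> \<in> P2. W2 \<nu> \<mu> < r})"

definition locally_lipschitz_around ::
  "('a::euclidean_space measure \<Rightarrow> real) \<Rightarrow> 'a measure \<Rightarrow> bool" where
  "locally_lipschitz_around G \<mu> \<longleftrightarrow>
     (\<exists>r>0. \<exists>L. \<forall>\<nu>1\<in>P2. \<forall>\<nu>2\<in>P2. W2 \<nu>1 \<mu> < r \<longrightarrow> W2 \<nu>2 \<mu> < r \<longrightarrow>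
        \<bar>G \<nu>1 - G \<nu>2\<bar> \<le> L * W2 \<nu>1 \<nu>2)"

text \<open>Elements of \<open>L2 \<mu>\<close> are functions, not classes modulo \<open>\<mu>\<close>-almost everywhere equality.\<close>

definition L2 :: "'a::euclidean_space measure \<Rightarrow> ('a \<Rightarrow> 'a) set" where
  "L2 \<mu> = {f \<in> borel_measurable \<mu>. integrable \<mu> (\<lambda>x. (norm (f x))\<^sup>2)}"

definition L2_inner ::
  "'a::euclidean_space measure \<Rightarrow> ('a \<Rightarrow> 'a) \<Rightarrow> ('a \<Rightarrow> 'a) \<Rightarrow> real" where
  "L2_inner \<mu> f g = (\<integral>x. f x \<bullet> g x \<partial>\<mu>)"

definition L2_weak_topology :: "'a::euclidean_space measure \<Rightarrow> ('a \<Rightarrow> 'a) topology" where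
  "L2_weak_topology \<mu> =
     topology_generated_by {{f \<in> L2 \<mu>. L2_inner \<mu> f g \<in> U} | g U. g \<in> L2 \<mu> \<and> open U}"

text \<open>Limit points of a sequence are its cluster points; in particular the limit of any convergent
  subsequence is one.\<close>

definition seq_limit_point_in :: "'b topology \<Rightarrow> (nat \<Rightarrow> 'b) \<Rightarrow> 'b \<Rightarrow> bool" where
  "seq_limit_point_in T x l \<longleftrightarrow>
     l \<in> topspace T \<and> (\<forall>U. openin T U \<and> l \<in> U \<longrightarrow> (\<exists>\<^sub>F n in sequentially. x n \<in> U))"

text \<open>\<open>disintegration \<mu> \<gamma> \<kappa>\<close> says that \<open>\<gamma>(dx, dy) = \<mu>(dx) \<kappa>\<^sub>x(dy)\<close> with \<open>\<kappa>\<close> a probability kernel.\<close>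

definition disintegration ::
  "'a::euclidean_space measure \<Rightarrow> ('a \<times> 'a) measure \<Rightarrow> ('a \<Rightarrow> 'a measure) \<Rightarrow> bool" where
  "disintegration \<mu> \<gamma> \<kappa> \<longleftrightarrow>
     \<kappa> \<in> measurable \<mu> (prob_algebra borel) \<and>
     (\<forall>C\<in>sets borel. emeasure \<gamma> C = (\<integral>\<^sup>+x. emeasure (\<kappa> x) (Pair x -` C) \<partial>\<mu>))"

text \<open>The kernel is only determined almost everywhere with respect to the first marginal of \<open>\<gamma>\<close>;
  hence the choice.\<close>

definition pullback :: "('a::euclidean_space \<times> 'a) measure \<Rightarrow> ('a \<Rightarrow> 'a) \<Rightarrow> 'a \<Rightarrow> 'a" where
  "pullback \<gamma> \<beta> x =
     (\<integral>y. \<beta> y \<partial>((SOME \<kappa>. disintegration (distr \<gamma> borel fst) \<gamma> \<kappa>) x))"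

definition C1_maps :: "('a::euclidean_space \<Rightarrow> 'a) set" where
  "C1_maps = {w. continuous_on UNIV w \<and> bdd_above (range (\<lambda>x. norm (w x) / (1 + norm x)))}"

text \<open>The upper limit is taken in the extended reals. Since \<open>W2_nhds \<mu>\<close> is not punctured,
  \<open>\<nu> = \<mu>\<close> is allowed.\<close>

definition clarke_derivative ::
  "('a::euclidean_space measure \<Rightarrow> real) \<Rightarrow> 'a measure \<Rightarrow> ('a \<Rightarrow> 'a) \<Rightarrow> ereal" where
  "clarke_derivative G \<mu> w =
     Limsup (W2_nhds \<mu> \<times>\<^sub>F at_right 0)
       (\<lambda>(\<nu>, t). ereal ((G (distr \<nu> borel (\<lambda>x. x + t *\<^sub>R w x)) - G \<nu>) / t))"

definition clarke_subdifferential ::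
  "('a::euclidean_space measure \<Rightarrow> real) \<Rightarrow> 'a measure \<Rightarrow> ('a \<Rightarrow> 'a) set" where
  "clarke_subdifferential G \<mu> =
     {\<Xi> \<in> L2 \<mu>. \<forall>w\<in>C1_maps. ereal (L2_inner \<mu> \<Xi> w) \<le> clarke_derivative G \<mu> w}"

end

theory Submission
  imports Defs
begin

text \<open>Let \<open>w\<close> be continuous with linear growth. Since the increments \<open>w (y) - w (x)\<close> tend to zero in
  \<open>L\<^sup>2(\<gamma>\<^sub>n)\<close> when the displacement does, pairing the pullback of \<open>\<Xi>\<^sub>n\<close> with \<open>w\<close> over \<open>\<mu>\<close> and pairing
  \<open>\<Xi>\<^sub>n\<close> with \<open>w\<close> over \<open>\<mu>\<^sub>n\<close> differ by \<open>o(1)\<close>, provided the norms of \<open>\<Xi>\<^sub>n\<close> stay bounded. They are bounded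
  by the Lipschitz constant \<open>L\<close> of \<open>G\<close>: the Clarke derivative at \<open>\<nu>\<close> in direction \<open>w\<close> is at most \<open>L\<close> times the
  norm of \<open>w\<close> over \<open>\<nu>\<close>, and these directions are dense. The Clarke derivative is upper
  semicontinuous in the base point, because by the triangle inequality a neighbourhood of \<open>\<mu>\<close> is one
  of \<open>\<mu>\<^sub>n\<close> for large \<open>n\<close>; so the subgradient inequality passes to the limit. Both the triangle
  inequality (by gluing) and the meaning of the pullback rest on the existence of disintegrations,
  which is reduced to conditional distribution functions by embedding the space measurably into the
  unit interval.\<close>

section \<open>Disintegration on Euclidean spaces\<close>

text \<open>A weak cluster point carries no bound on the sequence, so the norm bound has to come
  from the subdifferential itself. No subsequence is extracted: for each fixed \<open>w\<close>, a
  single subbasic weak neighbourhood already supplies infinitely many good indices. The increments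
  of \<open>w\<close> are delicate because \<open>w\<close> need be neither Lipschitz nor bounded:
  the tail must be charged to the fixed marginal \<mu>, not to the moving \<mu>_n. The same
  increment estimate controls how the norm of \<open>w\<close> varies with the measure, which
  matters because the upper limit in the Clarke derivative moves the base point. Formally the bound
  by \<open>L\<close> is the subgradient inequality tested with the subgradient itself, which need
  not be continuous; that is where density enters. Finally, \<open>pullback\<close> picks its kernel
  by choice and means nothing until some disintegration is known to exist.\<close>

definition quaternary :: "(nat \<Rightarrow> bool) \<Rightarrow> real" where
  "quaternary c = (\<Sum>i. of_bool (c i) / 4 ^ Suc i)"

lemma summable_quaternary: "summable (\<lambda>i. of_bool (c i) / 4 ^ Suc i :: real)"
proof (rule summable_comparison_test')
  show "summable (\<lambda>i. (1/4 :: real) ^ Suc i)"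
    unfolding summable_Suc_iff by (rule summable_geometric) simp
qed (auto simp: power_divide)

lemma quaternary_bounds: "0 \<le> quaternary c" "quaternary c < 1"
proof -
  show "0 \<le> quaternary c"
    unfolding quaternary_def by (rule suminf_nonneg[OF summable_quaternary]) simp
  have s: "(\<lambda>i. (1/4 :: real) ^ Suc i) sums (1/4 * (1 / (1 - 1/4)))"
    using sums_mult[OF geometric_sums[of "1/4::real"], of "1/4"] by simp
  have "quaternary c \<le> (\<Sum>i. (1/4 :: real) ^ Suc i)"
    unfolding quaternary_def
    by (rule suminf_le[OF _ summable_quaternary sums_summable[OF s]]) (auto simp: power_divide)
  also have "\<dots> < 1" using sums_unique[OF s] by simp
  finally show "quaternary c < 1" .
qed

text \<open>Multiplying by 4 moves the leading digit in front of the radix point and shifts the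
  rest; this drives the induction that reads off a digit.\<close>

lemma quaternary_shift: "4 * quaternary c = of_bool (c 0) + quaternary (\<lambda>i. c (Suc i))"
proof -
  have "quaternary c = of_bool (c 0) / 4 + (\<Sum>i. of_bool (c (Suc i)) / 4 ^ Suc (Suc i))"
    unfolding quaternary_def by (subst suminf_split_head[OF summable_quaternary]) simp
  also have "(\<Sum>i. of_bool (c (Suc i)) / 4 ^ Suc (Suc i) :: real) = quaternary (\<lambda>i. c (Suc i)) / 4"
    unfolding quaternary_def
    using suminf_divide[OF summable_quaternary[of "\<lambda>i. c (Suc i)"], of 4] by (simp add: mult.commute)
  finally show ?thesis by simp
qed

text \<open>The digits before \<open>c n\<close> contribute multiples of 4 to the integer part and
  the digits after it a remainder in [0, 1), so the parity of the integer part is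
  \<open>c n\<close>. With digits 0 and 1 in base 4 the remainder is at most 1/3, which excludes the
  carry that spoils base 2.\<close>

lemma odd_floor_quaternary: "odd \<lfloor>4 ^ Suc n * quaternary c\<rfloor> \<longleftrightarrow> c n"
proof (induction n arbitrary: c)
  case 0
  have "\<lfloor>4 * quaternary c\<rfloor> = of_bool (c 0)"
    unfolding quaternary_shift using quaternary_bounds[of "\<lambda>i. c (Suc i)"]
    by (auto simp: floor_eq_iff)
  then show ?case by simp
next
  case (Suc n)
  have "4 ^ Suc (Suc n) * quaternary c
      = of_int (4 ^ Suc n * of_bool (c 0)) + 4 ^ Suc n * quaternary (\<lambda>i. c (Suc i))"
    unfolding power_Suc2[of 4 "Suc n"] mult.assoc quaternary_shift by (simp add: distrib_left)
  then have "\<lfloor>4 ^ Suc (Suc n) * quaternary c\<rfloor>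
      = 4 ^ Suc n * of_bool (c 0) + \<lfloor>4 ^ Suc n * quaternary (\<lambda>i. c (Suc i))\<rfloor>"
    using floor_add_int[of "4 ^ Suc n * quaternary (\<lambda>i. c (Suc i))" "4 ^ Suc n * of_bool (c 0)"]
    by (simp only: add.commute)
  then show ?case using Suc.IH[of "\<lambda>i. c (Suc i)"] by simp
qed

text \<open>Recovers a coordinate from the countably many answers to \<open>q < x\<close>. In
  \<open>ereal\<close> the supremum exists unconditionally and -\<infinity> is neutral for it, so
  measurability needs no side conditions.\<close>

lemma SUP_rat_below:
  "(SUP q. if real_of_rat q < x then ereal (real_of_rat q) else -\<infinity>) = ereal x"
proof (rule antisym)
  show "(SUP q. if real_of_rat q < x then ereal (real_of_rat q) else -\<infinity>) \<le> ereal x"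
    by (rule SUP_least) auto
  show "ereal x \<le> (SUP q. if real_of_rat q < x then ereal (real_of_rat q) else -\<infinity>)"
  proof (rule dense_le)
    fix y assume "y < ereal x"
    then obtain z where z: "y < ereal z" "z < x" using ereal_dense2[of y "ereal x"] by auto
    obtain q where q: "z < of_rat q" "of_rat q < x" using of_rat_dense[OF z(2)] by auto
    have "y \<le> (if real_of_rat q < x then ereal (real_of_rat q) else -\<infinity>)"
      using z q by (simp add: less_imp_le order_trans[of y "ereal z"])
    also have "\<dots> \<le> (SUP q. if real_of_rat q < x then ereal (real_of_rat q) else -\<infinity>)"
      by (rule SUP_upper) simp
    finally show "y \<le> (SUP q. if real_of_rat q < x then ereal (real_of_rat q) else -\<infinity>)" .
  qed
qed

text \<open>The digits of \<open>\<phi> x\<close> in base 4 record which of the half-spaces \<open>{x. x \<bullet> b > q}\<close>, \<open>q\<close> rational,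
  contain \<open>x\<close>. All digits being 0 or 1, \<open>\<phi> x\<close> has no other expansion with such digits, so they
  can be read off measurably.\<close>

lemma borel_embedding_real:
  obtains \<phi> :: "'a::euclidean_space \<Rightarrow> real" and \<psi> :: "real \<Rightarrow> 'a"
  where "\<phi> \<in> borel_measurable borel" "\<psi> \<in> borel_measurable borel"
    "\<And>x. \<psi> (\<phi> x) = x" "\<And>x. 0 \<le> \<phi> x" "\<And>x. \<phi> x < 1"
proof -
  define e where "e = from_nat_into ((Basis :: 'a set) \<times> (UNIV :: rat set))"
  define k where "k = to_nat_on ((Basis :: 'a set) \<times> (UNIV :: rat set))"
  have cnt: "countable ((Basis :: 'a set) \<times> (UNIV :: rat set))"
    by (intro countable_SIGMA) (auto intro: countable_finite)
  have ek: "e (k (b, q)) = (b, q)" if "b \<in> Basis" for b q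
    unfolding e_def k_def using that cnt by (intro from_nat_into_to_nat_on) auto
  define \<phi> where
    "\<phi> x = quaternary (\<lambda>i. x \<bullet> fst (e i) > of_rat (snd (e i)))" for x
  \<comment> \<open>On the range of \<open>\<phi>\<close> the parity of the floor is the recorded
    answer for \<open>(b, q)\<close>. For other \<open>r\<close> the supremum can be infinite;
    \<open>real_of_ereal\<close> then yields 0, which keeps \<open>\<psi>\<close> total and
    measurable.\<close>
  define \<psi> where
    "\<psi> r = (\<Sum>b\<in>Basis. real_of_ereal (SUP q. if odd \<lfloor>4 ^ Suc (k (b, q)) * r\<rfloor>
        then ereal (of_rat q) else -\<infinity>) *\<^sub>R b)" for r :: real
  have "\<phi> \<in> borel_measurable borel"
    unfolding \<phi>_def quaternary_def of_bool_def by measurable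
  moreover have "\<psi> \<in> borel_measurable borel"
    unfolding \<psi>_def
    by (intro borel_measurable_sum borel_measurable_scaleR borel_measurable_const
        borel_measurable_real_of_ereal borel_measurable_SUP measurable_If) auto
  moreover have "\<psi> (\<phi> x) = x" for x
  proof -
    have "(SUP q. if odd \<lfloor>4 ^ Suc (k (b, q)) * \<phi> x\<rfloor> then ereal (of_rat q) else -\<infinity>) = ereal (x \<bullet> b)"
      if "b \<in> Basis" for b
      unfolding \<phi>_def odd_floor_quaternary ek[OF that] fst_conv snd_conv by (rule SUP_rat_below)
    then have "\<psi> (\<phi> x) = (\<Sum>b\<in>Basis. (x \<bullet> b) *\<^sub>R b)"
      unfolding \<psi>_def by (intro sum.cong) auto
    then show ?thesis by (simp add: euclidean_representation)
  qed
  ultimately show ?thesis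
    using that[of \<phi> \<psi>] quaternary_bounds by (auto simp: \<phi>_def)
qed

section \<open>Conditional distribution functions\<close>

text \<open>Tested on the set where \<open>g < f\<close>, the hypothesis makes the integral of the
  positive difference vanish, so that set is null. Finiteness of the integral of \<open>f\<close>
  protects the subtraction, since in \<open>ennreal\<close> a difference starting from infinity is
  infinite.\<close>

lemma AE_le_of_nn_integral_le:
  assumes "finite_measure M" and [measurable]: "f \<in> borel_measurable M" "g \<in> borel_measurable M"
    and fin: "(\<integral>\<^sup>+x. f x \<partial>M) < \<infinity>"
    and le: "\<And>A. A \<in> sets M \<Longrightarrow> (\<integral>\<^sup>+x. f x * indicator A x \<partial>M) \<le> (\<integral>\<^sup>+x. g x * indicator A x \<partial>M)"
  shows "AE x in M. f x \<le> (g x :: ennreal)"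
proof -
  define A where "A = {x \<in> space M. g x < f x}"
  have A[measurable]: "A \<in> sets M" unfolding A_def by measurable
  have fA: "(\<integral>\<^sup>+x. f x * indicator A x \<partial>M) < \<infinity>"
    by (rule le_less_trans[OF _ fin]) (auto intro!: nn_integral_mono simp: indicator_def)
  have "(\<integral>\<^sup>+x. g x * indicator A x \<partial>M) \<le> (\<integral>\<^sup>+x. f x * indicator A x \<partial>M)"
    by (intro nn_integral_mono) (auto simp: A_def indicator_def)
  then have gA: "(\<integral>\<^sup>+x. g x * indicator A x \<partial>M) \<noteq> \<infinity>"
    using fA by auto
  have "(\<integral>\<^sup>+x. f x * indicator A x - g x * indicator A x \<partial>M)
      = (\<integral>\<^sup>+x. f x * indicator A x \<partial>M) - (\<integral>\<^sup>+x. g x * indicator A x \<partial>M)"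
    by (rule nn_integral_diff) (use gA in \<open>auto simp: A_def indicator_def\<close>)
  also have "\<dots> = 0" using le[OF A] fA by (simp add: diff_eq_0_iff_ennreal)
  finally have "AE x in M. f x * indicator A x - g x * indicator A x = 0"
    by (subst (asm) nn_integral_0_iff_AE) auto
  moreover have "AE x in M. f x * indicator A x < \<infinity>"
    using nn_integral_PInf_AE[of "\<lambda>x. f x * indicator A x" M] fA by (auto simp: less_top)
  ultimately show ?thesis
    using AE_space by eventually_elim
      (rule ccontr, auto simp: A_def indicator_def diff_eq_0_iff_ennreal not_le)
qed

text \<open>\<open>h\<close> is a version of the conditional probability of
  \<open>snd z \<le> t\<close> given \<open>fst z\<close>. Outside the unit interval the constants 0
  and 1 are imposed pointwise; they later give the limits of the distribution function at both
  infinities for every \<open>x\<close>.\<close>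

lemma conditional_cdf_version:
  fixes \<gamma> :: "('a::euclidean_space \<times> real) measure"
  assumes "prob_space \<gamma>" and [measurable_cong]: "sets \<gamma> = sets borel"
    and unit: "AE z in \<gamma>. 0 \<le> snd z \<and> snd z < 1"
  shows "\<exists>h. h \<in> borel_measurable borel \<and> (\<forall>x. 0 \<le> h x) \<and> (\<forall>x. h x \<le> 1) \<and>
    (t < 0 \<longrightarrow> h = (\<lambda>x. 0)) \<and> (t \<ge> 1 \<longrightarrow> h = (\<lambda>x. 1)) \<and>
    (\<forall>A\<in>sets borel. (\<integral>\<^sup>+x. ennreal (h x) * indicator A x \<partial>distr \<gamma> borel fst)
        = emeasure \<gamma> (A \<times> {..t}))"
proof -
  interpret prob_space \<gamma> by fact
  define \<mu> where "\<mu> = distr \<gamma> borel fst"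
  have [measurable]: "fst \<in> \<gamma> \<rightarrow>\<^sub>M borel" "snd \<in> \<gamma> \<rightarrow>\<^sub>M borel"
    unfolding borel_prod[symmetric] measurable_cong_sets[OF assms(2) refl] by measurable
  interpret \<mu>: prob_space \<mu> unfolding \<mu>_def by (rule prob_space_distr) simp
  have sets_\<mu>[measurable_cong]: "sets \<mu> = sets borel" by (simp add: \<mu>_def)
  have space_\<gamma>[simp]: "space \<gamma> = UNIV" using sets_eq_imp_space_eq[OF assms(2)] by simp
  have AT: "A \<times> B \<in> sets \<gamma>" if "A \<in> sets borel" "B \<in> sets borel" for A :: "'a set" and B :: "real set"
    using that by (simp add: assms(2) borel_prod[symmetric])
  have \<mu>_eq: "emeasure \<mu> A = emeasure \<gamma> (A \<times> UNIV)" if "A \<in> sets borel" for A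
    using that by (auto simp: \<mu>_def emeasure_distr intro!: arg_cong[where f="emeasure \<gamma>"])
  consider "t < 0" | "t \<ge> 1" | "0 \<le> t" "t < 1" by linarith
  then show ?thesis
  proof cases
    case 1
    have "emeasure \<gamma> (A \<times> {..t}) = 0" if "A \<in> sets borel" for A
    proof -
      have "AE z in \<gamma>. z \<in> A \<times> {..t} \<longleftrightarrow> z \<in> {}"
        using unit by eventually_elim (use 1 in auto)
      then show ?thesis
        using emeasure_eq_AE[of "A \<times> {..t}" "{}" \<gamma>] that AT[of A "{..t}"] by simp
    qed
    then show ?thesis unfolding \<mu>_def[symmetric] using 1 by (intro exI[of _ "\<lambda>x. 0"]) auto
  next
    case 2
    have "emeasure \<mu> A = emeasure \<gamma> (A \<times> {..t})" if "A \<in> sets borel" for A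
    proof -
      have "AE z in \<gamma>. z \<in> A \<times> UNIV \<longleftrightarrow> z \<in> A \<times> {..t}"
        using unit by eventually_elim (use 2 in auto)
      then show ?thesis
        unfolding \<mu>_eq[OF that] using AT[OF that] by (intro emeasure_eq_AE) auto
    qed
    then show ?thesis unfolding \<mu>_def[symmetric] using 2 sets_\<mu> by (intro exI[of _ "\<lambda>x. 1"]) auto
  next
    case 3
    \<comment> \<open>The first marginal of \<open>\<gamma>\<close> restricted to second coordinate
      at most \<open>t\<close>. It is dominated by \<open>\<mu>\<close>, so its Radon-Nikodym
      derivative is at most 1 almost everywhere, and truncating that derivative at 1 changes it only
      on a null set.\<close>
    define \<nu> where "\<nu> = distr (density \<gamma> (indicator (UNIV \<times> {..t}))) borel fst"
    have \<nu>_eq: "emeasure \<nu> A = emeasure \<gamma> (A \<times> {..t})" if "A \<in> sets borel" for A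
    proof -
      have "emeasure \<nu> A = emeasure (density \<gamma> (indicator (UNIV \<times> {..t}))) (A \<times> UNIV)"
        using that unfolding \<nu>_def
        by (subst emeasure_distr) (auto intro!: arg_cong[where f="emeasure _"])
      also have "\<dots> = (\<integral>\<^sup>+z. indicator (UNIV \<times> {..t}) z * indicator (A \<times> UNIV) z \<partial>\<gamma>)"
        using AT[OF that, of UNIV] AT[of UNIV "{..t}"] by (intro emeasure_density) simp_all
      also have "\<dots> = (\<integral>\<^sup>+z. indicator (A \<times> {..t}) z \<partial>\<gamma>)"
        by (intro nn_integral_cong) (auto split: split_indicator)
      also have "\<dots> = emeasure \<gamma> (A \<times> {..t})"
        using AT[OF that, of "{..t}"] by simp
      finally show ?thesis .
    qed
    have \<nu>_le: "emeasure \<nu> A \<le> emeasure \<mu> A" if "A \<in> sets borel" for A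
      unfolding \<nu>_eq[OF that] \<mu>_eq[OF that] using AT[OF that, of UNIV]
      by (intro emeasure_mono Sigma_mono) auto
    have dens: "density \<mu> (RN_deriv \<mu> \<nu>) = \<nu>"
    proof (rule \<mu>.density_RN_deriv)
      show "absolutely_continuous \<mu> \<nu>"
        unfolding absolutely_continuous_def
      proof
        fix A assume "A \<in> null_sets \<mu>"
        then show "A \<in> null_sets \<nu>" using \<nu>_le[of A] by (auto simp: null_sets_def sets_\<mu> \<nu>_def)
      qed
    qed (simp add: \<nu>_def sets_\<mu>)
    define f where "f = RN_deriv \<mu> \<nu>"
    have f[measurable]: "f \<in> borel_measurable \<mu>" by (simp add: f_def)
    have f_eq: "(\<integral>\<^sup>+x. f x * indicator A x \<partial>\<mu>) = emeasure \<gamma> (A \<times> {..t})" if "A \<in> sets borel" for A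
    proof -
      have "emeasure (density \<mu> f) A = (\<integral>\<^sup>+x. f x * indicator A x \<partial>\<mu>)"
        using that by (intro emeasure_density f) (simp add: sets_\<mu>)
      then show ?thesis using dens \<nu>_eq[OF that] by (simp add: f_def)
    qed
    have "AE x in \<mu>. f x \<le> 1"
    proof (rule AE_le_of_nn_integral_le)
      show "(\<integral>\<^sup>+x. f x \<partial>\<mu>) < \<infinity>"
        using f_eq[of UNIV] emeasure_finite[of "UNIV \<times> {..t}"] by (simp add: less_top[symmetric])
      show "(\<integral>\<^sup>+x. f x * indicator A x \<partial>\<mu>) \<le> (\<integral>\<^sup>+x. 1 * indicator A x \<partial>\<mu>)" if "A \<in> sets \<mu>" for A
        using that \<nu>_le[of A] by (simp add: f_eq \<nu>_eq sets_\<mu>)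
    qed (auto simp: \<mu>.finite_measure_axioms)
    then have "AE x in \<mu>. ennreal (enn2real (min 1 (f x))) = f x"
      by eventually_elim (simp add: min_absorb2 le_less_trans[OF _ ennreal_one_less_top])
    then have "(\<integral>\<^sup>+x. ennreal (enn2real (min 1 (f x))) * indicator A x \<partial>\<mu>) = (\<integral>\<^sup>+x. f x * indicator A x \<partial>\<mu>)" for A
      by (intro nn_integral_cong_AE) (auto elim!: eventually_mono)
    moreover have "enn2real (min 1 (f x)) \<le> 1" for x
      using enn2real_mono[of "min 1 (f x)" 1] by simp
    moreover have "(\<lambda>x. enn2real (min 1 (f x))) \<in> borel_measurable borel"
      unfolding measurable_cong_sets[OF sets_\<mu>[symmetric] refl] by measurable
    ultimately show ?thesis unfolding \<mu>_def[symmetric] using 3 f_eq by (intro exI[of _ "\<lambda>x. enn2real (min 1 (f x))"]) auto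
  qed
qed

text \<open>The sets \<open>A \<times> {..t}\<close> are closed under intersection and generate the
  Borel sets, and those with \<open>A = UNIV\<close> and \<open>t\<close> a natural number exhaust
  the space.\<close>

lemma measure_eqI_times_atMost:
  fixes M N :: "('a::euclidean_space \<times> real) measure"
  assumes "finite_measure M" "sets M = sets borel" "sets N = sets borel"
    and eq: "\<And>A t. A \<in> sets borel \<Longrightarrow> emeasure M (A \<times> {..t}) = emeasure N (A \<times> {..t})"
  shows "M = N"
proof -
  interpret finite_measure M by fact
  define E where "E = {a \<times> b | a b. a \<in> sets (borel :: 'a measure) \<and> b \<in> range (atMost :: real \<Rightarrow> real set)}"
  have cover: "(\<Union>i. {..real i}) = UNIV"
    by (auto simp: real_arch_simple)
  have "sets ((borel :: 'a measure) \<Otimes>\<^sub>M (borel :: real measure)) = sets (sigma (space borel \<times> space borel) E)"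
    unfolding E_def
  proof (rule sets_pair_eq)
    show "sets (borel :: 'a measure) = sigma_sets (space borel) (sets borel)"
      using sets.sigma_sets_eq[of "borel :: 'a measure"] by simp
    show "sets (borel :: real measure) = sigma_sets (space borel) (range atMost)"
      by (subst borel_eq_atMost) simp
    show "\<Union>(range (\<lambda>i. {..real i})) = space borel" using cover by simp
    show "\<Union>{UNIV :: 'a set} = space borel" by simp
  qed auto
  then have gen: "sets (borel :: ('a \<times> real) measure) = sigma_sets UNIV E"
    unfolding borel_prod by simp
  show ?thesis
  proof (rule measure_eqI_generator_eq[where E = E and \<Omega> = UNIV and A = "\<lambda>i. UNIV \<times> {..real i}"])
    show "Int_stable E"
    proof (rule Int_stableI)
      fix S T assume "S \<in> E" "T \<in> E"
      then obtain a b s t where "S = a \<times> {..s}" "T = b \<times> {..t}" "a \<in> sets borel" "b \<in> sets borel"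
        unfolding E_def by blast
      then have "S \<inter> T = (a \<inter> b) \<times> {..min s t}" "a \<inter> b \<in> sets borel" by auto
      then show "S \<inter> T \<in> E" by (auto simp: E_def)
    qed
    have inE: "a \<times> {..t} \<in> E" if "a \<in> sets borel" for a and t :: real
      using that by (simp add: E_def) (metis rangeI)
    show "range (\<lambda>i. UNIV \<times> {..real i}) \<subseteq> E"
      by (rule image_subsetI) (simp add: inE)
    show "(\<Union>i. UNIV \<times> {..real i}) = (UNIV :: ('a \<times> real) set)"
      by (auto simp: real_arch_simple)
    show "emeasure M (UNIV \<times> {..real i}) \<noteq> \<infinity>" for i by simp
    show "emeasure M X = emeasure N X" if "X \<in> E" for X
      using that by (auto simp: E_def eq)
  qed (simp_all add: gen assms(2,3))
qed

section \<open>Kernel products and iterated integrals\<close>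

text \<open>The measure \<mu>(dx) \<kappa>_x(dy), written as a monadic bind so that the
  measurability and integration rules for \<open>bind\<close> apply. It lives on
  \<open>borel\<close> of the product type, as couplings do. The two factors have separate types
  because the base is a pair space when couplings are glued and the fibre is the real line when
  conditional distributions are built.\<close>

definition kernel_product ::
  "'b::topological_space measure \<Rightarrow> ('b \<Rightarrow> 'c::topological_space measure) \<Rightarrow> ('b \<times> 'c) measure" where
  "kernel_product \<mu> \<kappa> = \<mu> \<bind> (\<lambda>x. distr (\<kappa> x) borel (Pair x))"

context
  fixes \<mu> :: "'b::second_countable_topology measure"
    and \<kappa> :: "'b \<Rightarrow> 'c::second_countable_topology measure"
  assumes \<mu>: "sets \<mu> = sets borel" and \<kappa>: "\<kappa> \<in> \<mu> \<rightarrow>\<^sub>M prob_algebra borel"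
begin

lemma space_base: "space \<mu> = UNIV"
  using sets_eq_imp_space_eq[OF \<mu>] by simp

lemma sets_kernel: "sets (\<kappa> x) = sets borel" and prob_space_kernel: "prob_space (\<kappa> x)"
  using measurable_space[OF \<kappa>, of x] by (simp_all add: space_base space_prob_algebra)

lemma measurable_Pair_kernel: "Pair x \<in> \<kappa> x \<rightarrow>\<^sub>M (borel :: ('b \<times> 'c) measure)"
  unfolding borel_prod[symmetric] measurable_cong_sets[OF sets_kernel refl] by measurable

lemma measurable_distr_Pair_kernel:
  "(\<lambda>x. distr (\<kappa> x) borel (Pair x)) \<in> \<mu> \<rightarrow>\<^sub>M subprob_algebra (borel :: ('b \<times> 'c) measure)"
proof (rule measurable_distr2)
  show "\<kappa> \<in> \<mu> \<rightarrow>\<^sub>M subprob_algebra borel" by (rule measurable_prob_algebraD[OF \<kappa>])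
  show "case_prod Pair \<in> \<mu> \<Otimes>\<^sub>M borel \<rightarrow>\<^sub>M (borel :: ('b \<times> 'c) measure)"
    unfolding borel_prod[symmetric] measurable_cong_sets[OF sets_pair_measure_cong[OF \<mu> refl] refl]
    by measurable
qed

lemma measurable_base_pair:
  assumes "f \<in> measurable borel M"
  shows "(\<lambda>(x, y). f (x, y)) \<in> \<mu> \<Otimes>\<^sub>M (borel :: 'c measure) \<rightarrow>\<^sub>M M"
  using assms unfolding measurable_cong_sets[OF sets_pair_measure_cong[OF \<mu> refl] refl] borel_prod
  by (simp add: case_prod_eta)

lemma sets_kernel_product: "sets (kernel_product \<mu> \<kappa>) = sets borel"
  unfolding kernel_product_def by (rule sets_bind) (simp_all add: space_base)

lemma nn_integral_kernel_product:
  assumes f: "f \<in> borel_measurable borel"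
  shows "(\<integral>\<^sup>+z. f z \<partial>kernel_product \<mu> \<kappa>) = (\<integral>\<^sup>+x. \<integral>\<^sup>+y. f (x, y) \<partial>\<kappa> x \<partial>\<mu>)"
  unfolding kernel_product_def nn_integral_bind[OF f measurable_distr_Pair_kernel]
  by (simp add: nn_integral_distr[OF measurable_Pair_kernel] f)

lemma emeasure_kernel_product:
  assumes C: "C \<in> sets borel"
  shows "emeasure (kernel_product \<mu> \<kappa>) C = (\<integral>\<^sup>+x. emeasure (\<kappa> x) (Pair x -` C) \<partial>\<mu>)"
proof -
  have "emeasure (kernel_product \<mu> \<kappa>) C = (\<integral>\<^sup>+x. emeasure (distr (\<kappa> x) borel (Pair x)) C \<partial>\<mu>)"
    unfolding kernel_product_def
    by (rule emeasure_bind[OF _ measurable_distr_Pair_kernel C]) (simp add: space_base)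
  also have "\<dots> = (\<integral>\<^sup>+x. emeasure (\<kappa> x) (Pair x -` C) \<partial>\<mu>)"
    using sets_eq_imp_space_eq[OF sets_kernel]
    by (intro nn_integral_cong) (simp add: emeasure_distr[OF measurable_Pair_kernel C])
  finally show ?thesis .
qed

lemma borel_measurable_emeasure_kernel:
  assumes C: "C \<in> sets borel"
  shows "(\<lambda>x. emeasure (\<kappa> x) (Pair x -` C)) \<in> borel_measurable \<mu>"
  using measurable_compose[OF measurable_distr_Pair_kernel measurable_emeasure_subprob_algebra[OF C]]
    sets_eq_imp_space_eq[OF sets_kernel]
  by (simp add: emeasure_distr[OF measurable_Pair_kernel C])

lemma measurable_section_kernel:
  assumes f: "f \<in> borel_measurable borel"
  shows "(\<lambda>y. f (x, y)) \<in> borel_measurable (\<kappa> x)"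
  using measurable_compose[OF measurable_Pair_kernel f] .

lemma AE_integrable_kernel_product:
  fixes f :: "'b \<times> 'c \<Rightarrow> 'd::{banach, second_countable_topology}"
  assumes f: "integrable (kernel_product \<mu> \<kappa>) f"
  shows "AE x in \<mu>. integrable (\<kappa> x) (\<lambda>y. f (x, y))"
proof -
  have fm[measurable]: "f \<in> borel_measurable borel"
    using borel_measurable_integrable[OF f] unfolding measurable_cong_sets[OF sets_kernel_product refl] .
  have "(\<integral>\<^sup>+x. \<integral>\<^sup>+y. ennreal (norm (f (x, y))) \<partial>\<kappa> x \<partial>\<mu>) < \<infinity>"
    using f nn_integral_kernel_product[of "\<lambda>z. ennreal (norm (f z))"] by (simp add: integrable_iff_bounded)
  moreover have "(\<lambda>x. \<integral>\<^sup>+y. ennreal (norm (f (x, y))) \<partial>\<kappa> x) \<in> borel_measurable \<mu>"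
  proof (rule nn_integral_measurable_subprob_algebra2[where N = borel])
    show "(\<lambda>(x, y). ennreal (norm (f (x, y)))) \<in> borel_measurable (\<mu> \<Otimes>\<^sub>M borel)"
      by (rule measurable_base_pair) measurable
  qed (rule measurable_prob_algebraD[OF \<kappa>])
  ultimately have "AE x in \<mu>. (\<integral>\<^sup>+y. ennreal (norm (f (x, y))) \<partial>\<kappa> x) \<noteq> \<infinity>"
    by (intro nn_integral_PInf_AE) auto
  then show ?thesis
    by eventually_elim (simp add: integrable_iff_bounded measurable_section_kernel[OF fm] less_top)
qed

lemma borel_measurable_integral_kernel:
  fixes f :: "'b \<times> 'c \<Rightarrow> 'd::{banach, second_countable_topology}"
  assumes f: "f \<in> borel_measurable borel"
  shows "(\<lambda>x. \<integral>y. f (x, y) \<partial>\<kappa> x) \<in> borel_measurable \<mu>"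
  using measurable_compose[OF measurable_distr_Pair_kernel integral_measurable_subprob_algebra[OF f]]
  by (simp add: integral_distr[OF measurable_Pair_kernel f])

text \<open>Fubini for a kernel. The positive and negative parts are integrated by Tonelli; the
  inner integral is identified with the difference of the two only for almost every
  \<open>x\<close>, where the section is integrable.\<close>

lemma integral_kernel_product:
  fixes f :: "'b \<times> 'c \<Rightarrow> real"
  assumes f: "integrable (kernel_product \<mu> \<kappa>) f"
  shows "(\<integral>x. \<integral>y. f (x, y) \<partial>\<kappa> x \<partial>\<mu>) = (\<integral>z. f z \<partial>kernel_product \<mu> \<kappa>)"
proof -
  have fm[measurable]: "f \<in> borel_measurable borel"
    using borel_measurable_integrable[OF f] unfolding measurable_cong_sets[OF sets_kernel_product refl] .
  \<comment> \<open>Applied to \<open>f\<close> and to \<open>- f\<close>, with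
    \<open>ennreal\<close> cutting off the negative part. Finiteness of the double integral makes
    the inner one finite almost everywhere, so that \<open>enn2real\<close> loses nothing.\<close>
  have *: "(\<integral>x. enn2real (\<integral>\<^sup>+y. ennreal (g (x, y)) \<partial>\<kappa> x) \<partial>\<mu>) = enn2real (\<integral>\<^sup>+z. ennreal (g z) \<partial>kernel_product \<mu> \<kappa>)"
    "integrable \<mu> (\<lambda>x. enn2real (\<integral>\<^sup>+y. ennreal (g (x, y)) \<partial>\<kappa> x))"
    if gm[measurable]: "g \<in> borel_measurable borel" and gfin: "(\<integral>\<^sup>+z. ennreal (g z) \<partial>kernel_product \<mu> \<kappa>) < \<infinity>"
    for g :: "'b \<times> 'c \<Rightarrow> real"
  proof -
    let ?I = "\<lambda>x. \<integral>\<^sup>+y. ennreal (g (x, y)) \<partial>\<kappa> x"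
    have eq: "(\<integral>\<^sup>+z. ennreal (g z) \<partial>kernel_product \<mu> \<kappa>) = (\<integral>\<^sup>+x. ?I x \<partial>\<mu>)"
      by (rule nn_integral_kernel_product) measurable
    have I: "?I \<in> borel_measurable \<mu>"
    proof (rule nn_integral_measurable_subprob_algebra2[where N = borel])
      show "(\<lambda>(x, y). ennreal (g (x, y))) \<in> borel_measurable (\<mu> \<Otimes>\<^sub>M borel)"
        by (rule measurable_base_pair) measurable
    qed (rule measurable_prob_algebraD[OF \<kappa>])
    have "AE x in \<mu>. ?I x \<noteq> \<infinity>"
      using gfin unfolding eq by (intro nn_integral_PInf_AE I) simp
    then have ae: "AE x in \<mu>. ennreal (enn2real (?I x)) = ?I x"
      by eventually_elim (simp add: less_top[symmetric])
    have eq': "(\<integral>\<^sup>+x. ennreal (enn2real (?I x)) \<partial>\<mu>) = (\<integral>\<^sup>+x. ?I x \<partial>\<mu>)"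
      by (rule nn_integral_cong_AE[OF ae])
    show "(\<integral>x. enn2real (?I x) \<partial>\<mu>) = enn2real (\<integral>\<^sup>+z. ennreal (g z) \<partial>kernel_product \<mu> \<kappa>)"
      unfolding eq eq'[symmetric]
      by (intro integral_eq_nn_integral borel_measurable_enn2real I) simp
    show "integrable \<mu> (\<lambda>x. enn2real (?I x))"
      using gfin unfolding eq eq'[symmetric]
      by (intro integrableI_nonneg borel_measurable_enn2real I) simp_all
  qed
  have m: "(\<lambda>z. - f z) \<in> borel_measurable borel" by measurable
  have fin: "(\<integral>\<^sup>+z. ennreal (f z) \<partial>kernel_product \<mu> \<kappa>) < \<infinity>"
    "(\<integral>\<^sup>+z. ennreal (- f z) \<partial>kernel_product \<mu> \<kappa>) < \<infinity>"
    using f by (simp_all add: real_integrable_def less_top)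
  have "(\<integral>x. \<integral>y. f (x, y) \<partial>\<kappa> x \<partial>\<mu>)
      = (\<integral>x. enn2real (\<integral>\<^sup>+y. ennreal (f (x, y)) \<partial>\<kappa> x) - enn2real (\<integral>\<^sup>+y. ennreal (- f (x, y)) \<partial>\<kappa> x) \<partial>\<mu>)"
  proof (rule Bochner_Integration.integral_cong_AE)
    show "AE x in \<mu>. (\<integral>y. f (x, y) \<partial>\<kappa> x) = enn2real (\<integral>\<^sup>+y. ennreal (f (x, y)) \<partial>\<kappa> x) - enn2real (\<integral>\<^sup>+y. ennreal (- f (x, y)) \<partial>\<kappa> x)"
      using AE_integrable_kernel_product[OF f] by eventually_elim (rule real_lebesgue_integral_def)
    show "(\<lambda>x. \<integral>y. f (x, y) \<partial>\<kappa> x) \<in> borel_measurable \<mu>"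
      by (rule borel_measurable_integral_kernel[OF fm])
    show "(\<lambda>x. enn2real (\<integral>\<^sup>+y. ennreal (f (x, y)) \<partial>\<kappa> x) - enn2real (\<integral>\<^sup>+y. ennreal (- f (x, y)) \<partial>\<kappa> x)) \<in> borel_measurable \<mu>"
      by (rule borel_measurable_diff[OF borel_measurable_integrable[OF *(2)[OF fm fin(1)]]
          borel_measurable_integrable[OF *(2)[OF m fin(2)]]])
  qed
  also have "\<dots> = (\<integral>z. f z \<partial>kernel_product \<mu> \<kappa>)"
    by (simp only: real_lebesgue_integral_def[OF f]
        Bochner_Integration.integral_diff[OF *(2)[OF fm fin(1)] *(2)[OF m fin(2)]]
        *(1)[OF fm fin(1)] *(1)[OF m fin(2)])
  finally show ?thesis .
qed

end

text \<open>Each conditional distribution function is only determined up to a null set. Taking the infimum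
  over the rationals \<open>q > t\<close> of versions that are constant outside the unit interval yields a genuine
  distribution function for every \<open>x\<close>, without an exceptional null set.\<close>

lemma disintegration_unit_interval:
  fixes \<gamma> :: "('a::euclidean_space \<times> real) measure"
  assumes "prob_space \<gamma>" and [measurable_cong]: "sets \<gamma> = sets borel"
    and unit: "AE z in \<gamma>. 0 \<le> snd z \<and> snd z < 1"
  obtains \<kappa> where "\<kappa> \<in> borel \<rightarrow>\<^sub>M prob_algebra borel"
    "\<gamma> = kernel_product (distr \<gamma> borel fst) \<kappa>"
proof -
  interpret prob_space \<gamma> by fact
  define \<mu> where "\<mu> = distr \<gamma> borel fst"
  have [measurable]: "fst \<in> \<gamma> \<rightarrow>\<^sub>M borel"
    unfolding borel_prod[symmetric] measurable_cong_sets[OF assms(2) refl] by measurable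
  interpret \<mu>: prob_space \<mu> unfolding \<mu>_def by (rule prob_space_distr) simp
  have sets_\<mu>[measurable_cong]: "sets \<mu> = sets borel" and space_\<mu>[simp]: "space \<mu> = UNIV"
    by (simp_all add: \<mu>_def)
  have AT: "A \<times> {..t} \<in> sets \<gamma>" if "A \<in> sets borel" for A :: "'a set" and t :: real
    using that by (simp add: assms(2) borel_prod[symmetric])
  define V where "V t h \<longleftrightarrow> h \<in> borel_measurable borel \<and> (\<forall>x. 0 \<le> h x) \<and> (\<forall>x. h x \<le> 1) \<and>
    (t < 0 \<longrightarrow> h = (\<lambda>x. 0)) \<and> (t \<ge> 1 \<longrightarrow> h = (\<lambda>x. 1)) \<and>
    (\<forall>A\<in>sets borel. (\<integral>\<^sup>+x. ennreal (h x) * indicator A x \<partial>\<mu>) = emeasure \<gamma> (A \<times> {..t}))"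
    for t :: real and h :: "'a \<Rightarrow> real"
  have "\<exists>h. \<forall>t. V t (h t)"
    using conditional_cdf_version[OF assms] unfolding V_def \<mu>_def by (intro choice allI)
  then obtain h where V: "\<And>t. V t (h t)" by blast
  have h_meas[measurable]: "h t \<in> borel_measurable borel" for t using V[of t] by (simp add: V_def)
  have h01: "0 \<le> h t x" "h t x \<le> 1" for t x using V[of t] by (simp_all add: V_def)
  have h_neg: "h t = (\<lambda>x. 0)" if "t < 0" for t using V[of t] that by (simp add: V_def)
  have h_ge1: "h t = (\<lambda>x. 1)" if "t \<ge> 1" for t using V[of t] that by (simp add: V_def)
  have h_int: "(\<integral>\<^sup>+x. ennreal (h t x) * indicator A x \<partial>\<mu>) = emeasure \<gamma> (A \<times> {..t})"
    if "A \<in> sets borel" for t A using V[of t] that by (simp add: V_def)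
  \<comment> \<open>Strictly larger rationals: a \<open>q\<close> that nearly attains the infimum at
    \<open>a\<close> remains admissible for all \<open>t\<close> in \<open>(a, q)\<close>, which
    gives right continuity.\<close>
  define Q where "Q t = {q \<in> \<rat>. t < q}" for t :: real
  have cQ: "countable (Q t)" for t
    unfolding Q_def using countable_rat by (rule countable_subset[rotated]) auto
  have Q_ex: "\<exists>q\<in>Q t. q < s" if "t < s" for t s
    using Rats_dense_in_real[OF that] by (auto simp: Q_def)
  have Q_ne: "Q t \<noteq> {}" for t using Q_ex[of t "t + 1"] by auto
  define G where "G x t = (INF q\<in>Q t. h q x)" for x t
  have bdd: "bdd_below ((\<lambda>q. h q x) ` Q t)" for x t using h01 by (auto intro!: bdd_belowI[of _ 0])
  have G_le: "G x t \<le> h q x" if "q \<in> Q t" for x t q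
    unfolding G_def using bdd that by (rule cINF_lower)
  have G_ge: "c \<le> G x t" if "\<And>q. q \<in> Q t \<Longrightarrow> c \<le> h q x" for c x t
    unfolding G_def using Q_ne that by (rule cINF_greatest)
  have G01: "0 \<le> G x t" for x t using h01 by (intro G_ge)
  have G_mono: "G x s \<le> G x t" if "s \<le> t" for x s t
    by (rule G_ge, rule G_le) (use that in \<open>auto simp: Q_def\<close>)
  have G_right: "continuous (at_right a) (G x)" for a x
    unfolding continuous_within
  proof (rule order_tendstoI)
    fix c assume "c < G x a"
    then show "\<forall>\<^sub>F t in at_right a. c < G x t"
      using G_mono[of a _ x] unfolding eventually_at_right_field
      by (intro exI[of _ "a + 1"]) (meson less_add_one less_imp_le less_le_trans)
  next
    fix c assume "G x a < c"
    then obtain q where q: "q \<in> Q a" "h q x < c" unfolding G_def using cINF_less_iff[OF Q_ne bdd] by auto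
    show "\<forall>\<^sub>F t in at_right a. G x t < c"
      unfolding eventually_at_right_field
      by (rule exI[of _ q]) (use q in \<open>auto simp: Q_def intro!: le_less_trans[OF G_le[of q] q(2)]\<close>)
  qed
  have G_neg: "G x t = 0" if "t < 0" for x t
    using Q_ex[OF that] G_le[of _ t x] G01[of x t] h_neg by (metis order_antisym)
  have G_ge1: "G x t = 1" if "t \<ge> 1" for x t
  proof -
    have "h q x = 1" if "q \<in> Q t" for q using that \<open>t \<ge> 1\<close> h_ge1[of q] by (auto simp: Q_def)
    then show ?thesis unfolding G_def using Q_ne by simp
  qed
  have G_bot: "(G x \<longlongrightarrow> 0) at_bot" for x
    by (rule tendsto_eventually) (auto simp: eventually_at_bot_dense G_neg intro!: exI[of _ 0])
  have G_top: "(G x \<longlongrightarrow> 1) at_top" for x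
    by (rule tendsto_eventually) (auto simp: eventually_at_top_linorder G_ge1 intro!: exI[of _ 1])
  have G_meas[measurable]: "(\<lambda>x. G x t) \<in> borel_measurable borel" for t
    unfolding G_def using cQ by measurable
  have G_int: "(\<integral>\<^sup>+x. ennreal (G x t) * indicator A x \<partial>\<mu>) = emeasure \<gamma> (A \<times> {..t})"
    if A[measurable]: "A \<in> sets borel" for A t
  proof (rule antisym)
    \<comment> \<open>Upper bound: a rational between \<open>t\<close> and \<open>s\<close> bounds
      the integral by the mass of \<open>A \<times> {..s}\<close>; then \<open>s\<close> decreases
      to \<open>t\<close> by continuity from above.\<close>
    have le: "(\<integral>\<^sup>+x. ennreal (G x t) * indicator A x \<partial>\<mu>) \<le> emeasure \<gamma> (A \<times> {..s})" if ts: "t < s" for s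
    proof -
      obtain q where q: "q \<in> Q t" "q < s" using Q_ex[OF ts] by auto
      have "(\<integral>\<^sup>+x. ennreal (G x t) * indicator A x \<partial>\<mu>) \<le> (\<integral>\<^sup>+x. ennreal (h q x) * indicator A x \<partial>\<mu>)"
        using q G_le by (intro nn_integral_mono mult_right_mono ennreal_leI) auto
      also have "\<dots> \<le> emeasure \<gamma> (A \<times> {..s})"
        unfolding h_int[OF A] using q A AT by (intro emeasure_mono) auto
      finally show ?thesis .
    qed
    have eq: "(\<Inter>i. A \<times> {..t + 1 / real (Suc i)}) = A \<times> {..t}"
    proof -
      have "y \<le> t" if *: "\<And>i. y \<le> t + 1 / real (Suc i)" for y
      proof (rule ccontr)
        assume "\<not> y \<le> t"
        then obtain i where "inverse (real (Suc i)) < y - t" using reals_Archimedean[of "y - t"] by auto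
        then show False using *[of i] by (simp add: inverse_eq_divide)
      qed
      moreover have "y \<le> t + 1 / real (Suc i)" if "y \<le> t" for y i
        using that by (simp add: add_increasing2)
      ultimately have "(\<forall>i. y \<le> t + 1 / real (Suc i)) \<longleftrightarrow> y \<le> t" for y by metis
      then show ?thesis by (simp add: set_eq_iff del: of_nat_Suc)
    qed
    have "(\<lambda>i. emeasure \<gamma> (A \<times> {..t + 1 / real (Suc i)})) \<longlonglongrightarrow> emeasure \<gamma> (A \<times> {..t})"
      unfolding eq[symmetric]
    proof (rule Lim_emeasure_decseq)
      have "1 / real (Suc n) \<le> 1 / real (Suc m)" if "m \<le> n" for m n
        using that by (intro divide_left_mono) auto
      then have "{..t + 1 / real (Suc n)} \<subseteq> {..t + 1 / real (Suc m)}" if "m \<le> n" for m n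
        using that by (meson add_left_mono atMost_subset_iff)
      then show "decseq (\<lambda>i. A \<times> {..t + 1 / real (Suc i)})"
        unfolding decseq_def by (intro allI impI Sigma_mono subset_refl)
    qed (use A AT in auto)
    then show "(\<integral>\<^sup>+x. ennreal (G x t) * indicator A x \<partial>\<mu>) \<le> emeasure \<gamma> (A \<times> {..t})"
      by (rule LIMSEQ_le_const) (auto intro!: le)
  next
    \<comment> \<open>Lower bound: for each \<open>q > t\<close> the two versions are ordered
      outside a null set, and countability of \<open>Q t\<close> collects these into one null
      set.\<close>
    have "AE x in \<mu>. ennreal (h t x) \<le> ennreal (h q x)" if "t < q" for q
    proof (rule AE_le_of_nn_integral_le)
      show "(\<integral>\<^sup>+x. ennreal (h t x) \<partial>\<mu>) < \<infinity>"
        using h_int[of UNIV t] emeasure_finite[of "UNIV \<times> {..t}"] by (simp add: less_top[symmetric])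
      fix B assume "B \<in> sets \<mu>"
      then have B: "B \<in> sets borel" by (simp add: sets_\<mu>)
      have "emeasure \<gamma> (B \<times> {..t}) \<le> emeasure \<gamma> (B \<times> {..q})"
        using that AT[OF B] by (intro emeasure_mono Sigma_mono) auto
      then show "(\<integral>\<^sup>+x. ennreal (h t x) * indicator B x \<partial>\<mu>) \<le> (\<integral>\<^sup>+x. ennreal (h q x) * indicator B x \<partial>\<mu>)"
        by (simp only: h_int[OF B])
    qed (auto simp: \<mu>.finite_measure_axioms)
    then have "AE x in \<mu>. \<forall>q\<in>Q t. h t x \<le> h q x"
      using h01 by (subst AE_ball_countable[OF cQ]) (auto simp: Q_def)
    then have "AE x in \<mu>. ennreal (h t x) \<le> ennreal (G x t)"
      by eventually_elim (auto intro!: ennreal_leI G_ge)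
    then have "(\<integral>\<^sup>+x. ennreal (h t x) * indicator A x \<partial>\<mu>) \<le> (\<integral>\<^sup>+x. ennreal (G x t) * indicator A x \<partial>\<mu>)"
      by (intro nn_integral_mono_AE) (auto elim!: eventually_mono intro!: mult_right_mono)
    then show "emeasure \<gamma> (A \<times> {..t}) \<le> (\<integral>\<^sup>+x. ennreal (G x t) * indicator A x \<partial>\<mu>)"
      by (simp add: h_int)
  qed
  define \<kappa> where "\<kappa> x = interval_measure (G x)" for x
  have \<kappa>_Iic: "emeasure (\<kappa> x) {..t} = G x t" for x t
    unfolding \<kappa>_def using G_mono G_right G_bot by (rule emeasure_interval_measure_Iic)
  have \<kappa>_prob: "prob_space (\<kappa> x)" for x
    unfolding \<kappa>_def using G_mono G_right G_bot G_top
    by (intro real_distribution.axioms(1) real_distribution_interval_measure)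
  have \<kappa>_meas: "\<kappa> \<in> borel \<rightarrow>\<^sub>M prob_algebra borel"
  proof (rule measurable_prob_algebra_generated)
    show "sets borel = sigma_sets UNIV (range atMost :: real set set)"
      by (subst borel_eq_atMost) simp
    show "Int_stable (range atMost :: real set set)"
      by (auto simp: Int_stable_def)
    show "sets (\<kappa> x) = sets borel" for x by (simp add: \<kappa>_def)
  qed (use \<kappa>_prob in \<open>auto simp: \<kappa>_Iic\<close>)
  then have \<kappa>_meas': "\<kappa> \<in> \<mu> \<rightarrow>\<^sub>M prob_algebra borel" by simp
  have "\<gamma> = kernel_product \<mu> \<kappa>"
  proof (rule measure_eqI_times_atMost)
    fix A :: "'a set" and t :: real assume A: "A \<in> sets borel"
    have "emeasure (\<kappa> x) (Pair x -` (A \<times> {..t})) = ennreal (G x t) * indicator A x" for x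
    proof -
      have "Pair x -` (A \<times> {..t}) = (if x \<in> A then {..t} else {})" by auto
      then show ?thesis by (simp add: \<kappa>_Iic)
    qed
    then show "emeasure \<gamma> (A \<times> {..t}) = emeasure (kernel_product \<mu> \<kappa>) (A \<times> {..t})"
      using AT[OF A, of t] assms(2)
      by (simp add: emeasure_kernel_product[OF sets_\<mu> \<kappa>_meas'] G_int[OF A])
  qed (simp_all add: assms(2) sets_kernel_product[OF sets_\<mu> \<kappa>_meas'] finite_measure_axioms)
  with \<kappa>_meas show ?thesis unfolding \<mu>_def by (rule that)
qed

section \<open>Disintegration of couplings and the pairing with a pullback\<close>

lemma disintegration_exists:
  fixes \<gamma> :: "('a::euclidean_space \<times> 'a) measure"
  assumes "prob_space \<gamma>" and sets_\<gamma>: "sets \<gamma> = sets borel"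
  shows "\<exists>\<kappa>. disintegration (distr \<gamma> borel fst) \<gamma> \<kappa>"
proof -
  obtain \<phi> :: "'a \<Rightarrow> real" and \<psi> where \<phi>\<psi>[measurable]: "\<phi> \<in> borel_measurable borel" "\<psi> \<in> borel_measurable borel"
    and inv: "\<And>x. \<psi> (\<phi> x) = x" and unit: "\<And>x. 0 \<le> \<phi> x" "\<And>x. \<phi> x < 1"
    using borel_embedding_real by blast
  define \<Phi> where "\<Phi> = (\<lambda>z. (fst z, \<phi> (snd z)) :: 'a \<times> real)"
  have \<Phi>': "\<Phi> \<in> borel \<rightarrow>\<^sub>M borel"
    unfolding \<Phi>_def borel_prod[symmetric] by measurable
  have \<Phi>: "\<Phi> \<in> \<gamma> \<rightarrow>\<^sub>M borel"
    using \<Phi>' unfolding measurable_cong_sets[OF sets_\<gamma> refl] .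
  define \<mu> where "\<mu> = distr \<gamma> borel fst"
  have fst: "distr (distr \<gamma> borel \<Phi>) borel fst = \<mu>"
  proof -
    have "fst \<in> (borel :: ('a \<times> real) measure) \<rightarrow>\<^sub>M (borel :: 'a measure)"
      unfolding borel_prod[symmetric] by measurable
    then show ?thesis unfolding \<mu>_def by (subst distr_distr[OF _ \<Phi>]) (simp_all add: \<Phi>_def comp_def)
  qed
  have prob: "prob_space (distr \<gamma> borel \<Phi>)"
    using assms(1) \<Phi> by (rule prob_space.prob_space_distr)
  have unit': "AE z in distr \<gamma> borel \<Phi>. 0 \<le> snd z \<and> snd z < 1"
  proof (subst AE_distr_iff[OF \<Phi>])
    show "{z \<in> space borel. 0 \<le> snd z \<and> snd z < 1} \<in> sets (borel :: ('a \<times> real) measure)"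
      unfolding borel_prod[symmetric] by measurable
  qed (simp add: \<Phi>_def unit)
  obtain \<kappa> where \<kappa>: "\<kappa> \<in> borel \<rightarrow>\<^sub>M prob_algebra borel"
      and eq: "distr \<gamma> borel \<Phi> = kernel_product \<mu> \<kappa>"
    by (rule disintegration_unit_interval[OF prob sets_distr unit', unfolded fst])
  have sets_\<mu>: "sets \<mu> = sets borel" by (simp add: \<mu>_def)
  have \<kappa>_\<mu>: "\<kappa> \<in> \<mu> \<rightarrow>\<^sub>M prob_algebra borel"
    using \<kappa> unfolding measurable_cong_sets[OF sets_\<mu> refl] .
  note ker = sets_kernel[OF sets_\<mu> \<kappa>_\<mu>]
  have \<psi>_ker: "\<psi> \<in> \<kappa> x \<rightarrow>\<^sub>M borel" for x
    using \<phi>\<psi>(2) unfolding measurable_cong_sets[OF ker refl] .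
  have "disintegration \<mu> \<gamma> (\<lambda>x. distr (\<kappa> x) borel \<psi>)"
    unfolding disintegration_def
  proof (intro conjI ballI)
    show "(\<lambda>x. distr (\<kappa> x) borel \<psi>) \<in> \<mu> \<rightarrow>\<^sub>M prob_algebra borel"
      by (rule measurable_compose[OF \<kappa>_\<mu> measurable_distr_prob_space[OF \<phi>\<psi>(2)]])
    fix C :: "('a \<times> 'a) set" assume C: "C \<in> sets borel"
    define D where "D = (\<lambda>z. (fst z, \<psi> (snd z))) -` C"
    have \<Psi>: "(\<lambda>z. (fst z, \<psi> (snd z))) \<in> borel \<rightarrow>\<^sub>M (borel :: ('a \<times> 'a) measure)"
      unfolding borel_prod[symmetric] by measurable
    have D: "D \<in> sets borel"
      using measurable_sets[OF \<Psi> C] by (simp add: D_def)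
    \<comment> \<open>This is where the left inverse enters: the image kernel may charge points
      outside the range of \<open>\<phi>\<close>, yet \<open>C\<close> is exactly the preimage of
      the set \<open>D\<close> on which that kernel is evaluated.\<close>
    have "\<Phi> -` D = C" by (auto simp: \<Phi>_def D_def inv)
    then have "emeasure \<gamma> C = emeasure (distr \<gamma> borel \<Phi>) D"
      using sets_eq_imp_space_eq[OF sets_\<gamma>] by (simp add: emeasure_distr[OF \<Phi> D])
    also have "\<dots> = (\<integral>\<^sup>+x. emeasure (\<kappa> x) (Pair x -` D) \<partial>\<mu>)"
      unfolding eq by (rule emeasure_kernel_product[OF sets_\<mu> \<kappa>_\<mu> D])
    also have "\<dots> = (\<integral>\<^sup>+x. emeasure (distr (\<kappa> x) borel \<psi>) (Pair x -` C) \<partial>\<mu>)"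
    proof (rule nn_integral_cong)
      fix x
      have "Pair x \<in> (borel :: 'a measure) \<rightarrow>\<^sub>M (borel :: ('a \<times> 'a) measure)"
        unfolding borel_prod[symmetric] by measurable
      then have "Pair x -` C \<in> sets borel"
        using measurable_sets[OF _ C, of "Pair x" borel] by simp
      moreover have "Pair x -` D = \<psi> -` (Pair x -` C)" by (auto simp: D_def)
      ultimately show "emeasure (\<kappa> x) (Pair x -` D) = emeasure (distr (\<kappa> x) borel \<psi>) (Pair x -` C)"
        using sets_eq_imp_space_eq[OF ker] by (simp add: emeasure_distr[OF \<psi>_ker])
    qed
    finally show "emeasure \<gamma> C = (\<integral>\<^sup>+x. emeasure (distr (\<kappa> x) borel \<psi>) (Pair x -` C) \<partial>\<mu>)" .
  qed
  then show ?thesis unfolding \<mu>_def by blast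
qed

lemma disintegration_kernel_product:
  assumes "disintegration \<mu> \<gamma> \<kappa>" "sets \<mu> = sets borel" "sets \<gamma> = sets borel"
  shows "\<gamma> = kernel_product \<mu> \<kappa>"
proof (rule measure_eqI)
  have \<kappa>: "\<kappa> \<in> \<mu> \<rightarrow>\<^sub>M prob_algebra borel" using assms(1) by (simp add: disintegration_def)
  show "sets \<gamma> = sets (kernel_product \<mu> \<kappa>)"
    by (simp add: sets_kernel_product[OF assms(2) \<kappa>] assms(3))
  show "emeasure \<gamma> C = emeasure (kernel_product \<mu> \<kappa>) C" if "C \<in> sets \<gamma>" for C
    using assms that by (simp add: emeasure_kernel_product[OF assms(2) \<kappa>] disintegration_def)
qed

text \<open>Once a disintegration exists, \<open>SOME\<close> returns one, and Fubini applies
  whichever kernel it is. Integrability of \<open>\<beta>\<close> along almost every fibre lets the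
  inner product with \<open>w x\<close> move under the inner integral.\<close>

lemma L2_inner_pullback:
  fixes \<gamma> :: "('a::euclidean_space \<times> 'a) measure"
  assumes "prob_space \<gamma>" and sets_\<gamma>: "sets \<gamma> = sets borel"
    and [measurable]: "\<beta> \<in> borel_measurable borel" "w \<in> borel_measurable borel"
    and int_\<beta>: "integrable \<gamma> (\<lambda>z. \<beta> (snd z))" and int: "integrable \<gamma> (\<lambda>z. \<beta> (snd z) \<bullet> w (fst z))"
  shows "L2_inner (distr \<gamma> borel fst) (pullback \<gamma> \<beta>) w = (\<integral>z. \<beta> (snd z) \<bullet> w (fst z) \<partial>\<gamma>)"
proof -
  define \<mu> where "\<mu> = distr \<gamma> borel fst"
  have sets_\<mu>: "sets \<mu> = sets borel" by (simp add: \<mu>_def)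
  define \<kappa> where "\<kappa> = (SOME \<kappa>. disintegration \<mu> \<gamma> \<kappa>)"
  have dis: "disintegration \<mu> \<gamma> \<kappa>"
    unfolding \<kappa>_def \<mu>_def by (rule someI_ex[OF disintegration_exists[OF assms(1,2)]])
  then have \<kappa>: "\<kappa> \<in> \<mu> \<rightarrow>\<^sub>M prob_algebra borel" by (simp add: disintegration_def)
  note \<gamma>_eq = disintegration_kernel_product[OF dis sets_\<mu> sets_\<gamma>]
  have \<beta>_snd: "(\<lambda>z. \<beta> (snd z)) \<in> borel_measurable (borel :: ('a \<times> 'a) measure)"
    and \<beta>_w: "(\<lambda>z. \<beta> (snd z) \<bullet> w (fst z)) \<in> borel_measurable (borel :: ('a \<times> 'a) measure)"
    unfolding borel_prod[symmetric] by measurable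
  have w': "w \<in> borel_measurable \<mu>" by (simp add: \<mu>_def)
  have "L2_inner \<mu> (pullback \<gamma> \<beta>) w = (\<integral>x. (\<integral>y. \<beta> y \<partial>\<kappa> x) \<bullet> w x \<partial>\<mu>)"
    by (simp add: L2_inner_def pullback_def \<kappa>_def \<mu>_def)
  also have "\<dots> = (\<integral>x. \<integral>y. \<beta> y \<bullet> w x \<partial>\<kappa> x \<partial>\<mu>)"
  proof (rule Bochner_Integration.integral_cong_AE)
    have "AE x in \<mu>. integrable (\<kappa> x) \<beta>"
      using AE_integrable_kernel_product[OF sets_\<mu> \<kappa>, of "\<lambda>z. \<beta> (snd z)"] int_\<beta>
      unfolding \<gamma>_eq[symmetric] by simp
    then show "AE x in \<mu>. (\<integral>y. \<beta> y \<partial>\<kappa> x) \<bullet> w x = (\<integral>y. \<beta> y \<bullet> w x \<partial>\<kappa> x)"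
      by eventually_elim simp
    show "(\<lambda>x. (\<integral>y. \<beta> y \<partial>\<kappa> x) \<bullet> w x) \<in> borel_measurable \<mu>"
      using borel_measurable_integral_kernel[OF sets_\<mu> \<kappa> \<beta>_snd] w'
      by (intro borel_measurable_inner) simp_all
    show "(\<lambda>x. \<integral>y. \<beta> y \<bullet> w x \<partial>\<kappa> x) \<in> borel_measurable \<mu>"
      using borel_measurable_integral_kernel[OF sets_\<mu> \<kappa> \<beta>_w] by simp
  qed
  also have "\<dots> = (\<integral>z. \<beta> (snd z) \<bullet> w (fst z) \<partial>\<gamma>)"
    using integral_kernel_product[OF sets_\<mu> \<kappa>, of "\<lambda>z. \<beta> (snd z) \<bullet> w (fst z)"] int
    unfolding \<gamma>_eq[symmetric] by simp
  finally show ?thesis by (simp only: \<mu>_def)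
qed

section \<open>The Wasserstein distance\<close>

lemma borel_measurable_fst_snd [measurable]:
  "fst \<in> (borel :: ('a::second_countable_topology \<times> 'b::second_countable_topology) measure) \<rightarrow>\<^sub>M borel"
  "snd \<in> (borel :: ('a \<times> 'b) measure) \<rightarrow>\<^sub>M borel"
  unfolding borel_prod[symmetric] by measurable

section \<open>Square-integrable maps\<close>

text \<open>\<open>L2\<close> contains only maps from the space to itself; couplings and glued
  triples need square-integrable maps on product domains, hence a predicate with a free domain
  type.\<close>

definition sq_integrable :: "'b measure \<Rightarrow> ('b \<Rightarrow> 'a::euclidean_space) \<Rightarrow> bool" where
  "sq_integrable M f \<longleftrightarrow> f \<in> borel_measurable M \<and> integrable M (\<lambda>x. (norm (f x))\<^sup>2)"

definition L2norm :: "'b measure \<Rightarrow> ('b \<Rightarrow> 'a::euclidean_space) \<Rightarrow> real" where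
  "L2norm M f = sqrt (\<integral>x. (norm (f x))\<^sup>2 \<partial>M)"

lemma L2_iff_sq_integrable: "f \<in> L2 \<mu> \<longleftrightarrow> sq_integrable \<mu> f"
  by (simp add: L2_def sq_integrable_def)

lemma sq_integrable_measurable: "sq_integrable M f \<Longrightarrow> f \<in> borel_measurable M"
  by (simp add: sq_integrable_def)

lemma L2norm_nonneg: "0 \<le> L2norm M f"
  by (simp add: L2norm_def)

lemma L2norm_power2: "(L2norm M f)\<^sup>2 = (\<integral>x. (norm (f x))\<^sup>2 \<partial>M)"
  by (simp add: L2norm_def)

lemma sq_integrable_bound:
  assumes "f \<in> borel_measurable M" "integrable M g" "\<And>x. (norm (f x))\<^sup>2 \<le> g x"
  shows "sq_integrable M f"
  unfolding sq_integrable_def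
  using assms by (intro conjI Bochner_Integration.integrable_bound[OF assms(2)]) (auto intro: order_trans[OF _ abs_ge_self])

lemma norm_add_power2_le: "(norm (x + y))\<^sup>2 \<le> 2 * (norm x)\<^sup>2 + 2 * (norm (y :: 'a::real_inner))\<^sup>2"
proof -
  have "(norm (x + y))\<^sup>2 + (norm (x - y))\<^sup>2 = 2 * (norm x)\<^sup>2 + 2 * (norm y)\<^sup>2"
    by (simp add: power2_norm_eq_inner inner_simps inner_commute)
  then show ?thesis using zero_le_power2[of "norm (x - y)"] by linarith
qed

lemma sq_integrable_add:
  assumes f: "sq_integrable M f" and g: "sq_integrable M g"
  shows "sq_integrable M (\<lambda>x. f x + g x)"
proof (rule sq_integrable_bound)
  show "integrable M (\<lambda>x. 2 * (norm (f x))\<^sup>2 + 2 * (norm (g x))\<^sup>2)"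
    using f g by (simp add: sq_integrable_def)
qed (use f g in \<open>auto simp: sq_integrable_def norm_add_power2_le\<close>)

lemma sq_integrable_scaleR: "sq_integrable M f \<Longrightarrow> sq_integrable M (\<lambda>x. c *\<^sub>R f x)"
  unfolding sq_integrable_def by (auto simp: power_mult_distrib intro: borel_measurable_scaleR)

lemma sq_integrable_diff:
  "sq_integrable M f \<Longrightarrow> sq_integrable M g \<Longrightarrow> sq_integrable M (\<lambda>x. f x - g x)"
  using sq_integrable_add[of M f "\<lambda>x. - 1 *\<^sub>R g x"] sq_integrable_scaleR[of M g "-1"] by simp

lemma sq_integrable_inner:
  assumes f: "sq_integrable M f" and g: "sq_integrable M g"
  shows "integrable M (\<lambda>x. f x \<bullet> g x)"
proof -
  have "(\<lambda>x. f x \<bullet> g x) = (\<lambda>x. ((norm (f x + g x))\<^sup>2 - (norm (f x))\<^sup>2 - (norm (g x))\<^sup>2) / 2)"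
    by (simp add: fun_eq_iff power2_norm_eq_inner inner_simps inner_commute)
  then show ?thesis
    using f g sq_integrable_add[OF f g] by (simp add: sq_integrable_def)
qed

text \<open>The integral of \<open>(norm (f x - t *\<^sub>R g x))\<^sup>2\<close> is a nonnegative
  quadratic in \<open>t\<close>. If its leading coefficient \<open>B\<close> vanishes, the choice
  \<open>t = (A + 1) / (2 * C)\<close> would give -1 unless \<open>C = 0\<close>; otherwise the
  vertex \<open>t = C / B\<close> yields the discriminant inequality.\<close>

lemma L2_Cauchy_Schwarz:
  assumes f: "sq_integrable M f" and g: "sq_integrable M g"
  shows "\<bar>\<integral>x. f x \<bullet> g x \<partial>M\<bar> \<le> L2norm M f * L2norm M g"
proof -
  define A where "A = (\<integral>x. (norm (f x))\<^sup>2 \<partial>M)"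
  define B where "B = (\<integral>x. (norm (g x))\<^sup>2 \<partial>M)"
  define C where "C = (\<integral>x. f x \<bullet> g x \<partial>M)"
  have quad: "0 \<le> A - 2 * t * C + t\<^sup>2 * B" for t
  proof -
    have "0 \<le> (\<integral>x. (norm (f x - t *\<^sub>R g x))\<^sup>2 \<partial>M)" by simp
    also have "\<dots> = (\<integral>x. (norm (f x))\<^sup>2 - 2 * t * (f x \<bullet> g x) + t\<^sup>2 * (norm (g x))\<^sup>2 \<partial>M)"
      by (intro Bochner_Integration.integral_cong refl)
        (simp only: power2_norm_eq_inner, simp add: inner_diff_left inner_diff_right inner_commute power2_eq_square algebra_simps)
    also have "\<dots> = A - 2 * t * C + t\<^sup>2 * B"
      using f g sq_integrable_inner[OF f g] by (simp add: sq_integrable_def A_def B_def C_def)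
    finally show ?thesis .
  qed
  have "C\<^sup>2 \<le> A * B"
  proof (cases "B = 0")
    case True
    show ?thesis
    proof (cases "C = 0")
      case False
      then show ?thesis using quad[of "(A + 1) / (2 * C)"] True by (simp add: field_simps)
    qed (simp add: True)
  next
    case False
    then have "B > 0" unfolding B_def by (simp add: less_le)
    then show ?thesis using quad[of "C / B"] by (simp add: field_simps power2_eq_square)
  qed
  then have "\<bar>C\<bar> \<le> sqrt (A * B)" by (rule real_le_rsqrt[of "\<bar>C\<bar>", simplified])
  then show ?thesis by (simp add: L2norm_def A_def B_def C_def real_sqrt_mult)
qed

lemma L2norm_add_le:
  assumes f: "sq_integrable M f" and g: "sq_integrable M g"
  shows "L2norm M (\<lambda>x. f x + g x) \<le> L2norm M f + L2norm M g"
proof (rule power2_le_imp_le)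
  have "(L2norm M (\<lambda>x. f x + g x))\<^sup>2 = (\<integral>x. (norm (f x))\<^sup>2 + 2 * (f x \<bullet> g x) + (norm (g x))\<^sup>2 \<partial>M)"
    unfolding L2norm_power2
    by (intro Bochner_Integration.integral_cong refl) (simp add: power2_norm_eq_inner inner_simps inner_commute)
  also have "\<dots> = (L2norm M f)\<^sup>2 + 2 * (\<integral>x. f x \<bullet> g x \<partial>M) + (L2norm M g)\<^sup>2"
    using f g sq_integrable_inner[OF f g] by (simp add: sq_integrable_def L2norm_power2)
  also have "\<dots> \<le> (L2norm M f + L2norm M g)\<^sup>2"
    using L2_Cauchy_Schwarz[OF f g] by (simp add: power2_sum)
  finally show "(L2norm M (\<lambda>x. f x + g x))\<^sup>2 \<le> (L2norm M f + L2norm M g)\<^sup>2" .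
qed (simp add: L2norm_nonneg)

lemma sq_integrable_distr:
  assumes "T \<in> measurable M N" "f \<in> borel_measurable N"
  shows "sq_integrable (distr M N T) f \<longleftrightarrow> sq_integrable M (\<lambda>x. f (T x))"
  using assms by (simp add: sq_integrable_def integrable_distr_eq)

lemma L2norm_distr:
  assumes "T \<in> measurable M N" "f \<in> borel_measurable N"
  shows "L2norm (distr M N T) f = L2norm M (\<lambda>x. f (T x))"
  using assms by (simp add: L2norm_def integral_distr)

section \<open>Couplings and the metric properties of \<open>W2\<close>\<close>

lemma P2_D:
  assumes "\<mu> \<in> P2"
  shows "prob_space \<mu>" "sets \<mu> = sets borel" "space \<mu> = UNIV" "sq_integrable \<mu> (\<lambda>x. x)"
    "measurable \<mu> N = measurable borel N"
  using assms sets_eq_imp_space_eq[of \<mu> borel]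
  by (auto simp: P2_def sq_integrable_def measurable_ident_sets cong: measurable_cong_sets)

lemma couplings_D:
  assumes "\<gamma> \<in> couplings \<mu> \<nu>"
  shows "prob_space \<gamma>" "sets \<gamma> = sets borel" "distr \<gamma> borel fst = \<mu>" "distr \<gamma> borel snd = \<nu>"
    "space \<gamma> = UNIV" "measurable \<gamma> N = measurable borel N"
  using assms sets_eq_imp_space_eq[of \<gamma> borel] by (auto simp: couplings_def cong: measurable_cong_sets)

lemma couplings_transfer:
  assumes \<gamma>: "\<gamma> \<in> couplings \<mu> \<nu>" and [measurable]: "f \<in> borel_measurable borel"
  shows "sq_integrable \<gamma> (\<lambda>z. f (fst z)) \<longleftrightarrow> sq_integrable \<mu> f"
    "sq_integrable \<gamma> (\<lambda>z. f (snd z)) \<longleftrightarrow> sq_integrable \<nu> f"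
    "L2norm \<gamma> (\<lambda>z. f (fst z)) = L2norm \<mu> f"
    "L2norm \<gamma> (\<lambda>z. f (snd z)) = L2norm \<nu> f"
  using sq_integrable_distr[of fst \<gamma> borel f] sq_integrable_distr[of snd \<gamma> borel f]
    L2norm_distr[of fst \<gamma> borel f] L2norm_distr[of snd \<gamma> borel f] couplings_D[OF \<gamma>]
  by simp_all

lemma displacement_norm_eq_L2norm: "displacement_norm \<gamma> = L2norm \<gamma> (\<lambda>z. snd z - fst z)"
  by (simp add: displacement_norm_def L2norm_def)

lemma sq_integrable_displacement:
  assumes "\<gamma> \<in> couplings \<mu> \<nu>" "\<mu> \<in> P2" "\<nu> \<in> P2"
  shows "sq_integrable \<gamma> (\<lambda>z. snd z - fst z)"
  using couplings_transfer[OF assms(1), of "\<lambda>x. x"] P2_D(4)[OF assms(2)] P2_D(4)[OF assms(3)]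
  by (intro sq_integrable_diff) simp_all

text \<open>The product measure is a coupling, so the infimum in \<open>W2\<close> is over a
  nonempty set and has the usual approximation property.\<close>

lemma couplings_nonempty:
  assumes "\<mu> \<in> P2" "\<nu> \<in> P2"
  shows "couplings \<mu> \<nu> \<noteq> {}"
proof -
  interpret \<mu>: prob_space \<mu> using P2_D[OF assms(1)] by simp
  interpret \<nu>: prob_space \<nu> using P2_D[OF assms(2)] by simp
  interpret pair_prob_space \<mu> \<nu> ..
  have s: "sets (\<mu> \<Otimes>\<^sub>M \<nu>) = sets borel"
    using sets_pair_measure_cong[OF P2_D(2)[OF assms(1)] P2_D(2)[OF assms(2)]] unfolding borel_prod .
  have "distr (\<mu> \<Otimes>\<^sub>M \<nu>) borel fst = distr (\<mu> \<Otimes>\<^sub>M \<nu>) \<mu> fst"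
    by (rule distr_cong) (simp_all add: P2_D[OF assms(1)])
  moreover have "distr (\<mu> \<Otimes>\<^sub>M \<nu>) borel snd = \<nu>"
  proof (rule measure_eqI)
    fix A assume "A \<in> sets (distr (\<mu> \<Otimes>\<^sub>M \<nu>) borel snd)"
    then have A: "A \<in> sets borel" by simp
    have "emeasure (distr (\<mu> \<Otimes>\<^sub>M \<nu>) borel snd) A = emeasure (\<mu> \<Otimes>\<^sub>M \<nu>) (UNIV \<times> A)"
      using A by (subst emeasure_distr)
        (auto simp: space_pair_measure P2_D[OF assms(1)] P2_D[OF assms(2)] measurable_cong_sets[OF s refl] intro!: arg_cong[where f="emeasure _"])
    also have "\<dots> = emeasure \<nu> A"
      using A \<mu>.emeasure_space_1 by (simp add: \<nu>.emeasure_pair_measure_Times P2_D[OF assms(1)] P2_D[OF assms(2)])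
    finally show "emeasure (distr (\<mu> \<Otimes>\<^sub>M \<nu>) borel snd) A = emeasure \<nu> A" .
  qed (simp add: P2_D[OF assms(2)])
  ultimately have "\<mu> \<Otimes>\<^sub>M \<nu> \<in> couplings \<mu> \<nu>"
    by (simp add: couplings_def s prob_space_axioms \<nu>.distr_pair_fst)
  then show ?thesis by blast
qed

lemma bdd_below_displacement: "bdd_below (displacement_norm ` S)"
  by (auto intro!: bdd_belowI[of _ 0] simp: displacement_norm_def)

lemma W2_le: "\<gamma> \<in> couplings \<mu> \<nu> \<Longrightarrow> W2 \<mu> \<nu> \<le> displacement_norm \<gamma>"
  unfolding W2_def by (rule cINF_lower[OF bdd_below_displacement])

lemma W2_nonneg: "\<mu> \<in> P2 \<Longrightarrow> \<nu> \<in> P2 \<Longrightarrow> 0 \<le> W2 \<mu> \<nu>"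
  unfolding W2_def by (rule cINF_greatest[OF couplings_nonempty]) (auto simp: displacement_norm_def)

lemma W2_lessE:
  assumes "\<mu> \<in> P2" "\<nu> \<in> P2" "W2 \<mu> \<nu> < r"
  obtains \<gamma> where "\<gamma> \<in> couplings \<mu> \<nu>" "displacement_norm \<gamma> < r"
  using assms(3) cINF_less_iff[OF couplings_nonempty[OF assms(1,2)] bdd_below_displacement]
  unfolding W2_def by blast

lemma W2_commute_le:
  assumes "\<mu> \<in> P2" "\<nu> \<in> P2"
  shows "W2 \<mu> \<nu> \<le> W2 \<nu> \<mu>"
proof (rule dense_ge)
  fix r assume "W2 \<nu> \<mu> < r"
  then obtain \<gamma> where \<gamma>: "\<gamma> \<in> couplings \<nu> \<mu>" "displacement_norm \<gamma> < r"
    using W2_lessE assms by blast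
  define \<gamma>' where "\<gamma>' = distr \<gamma> borel (\<lambda>z. (snd z, fst z))"
  note c = couplings_D[OF \<gamma>(1)]
  have swap: "(\<lambda>z. (snd z, fst z)) \<in> \<gamma> \<rightarrow>\<^sub>M (borel :: ('a \<times> 'a) measure)"
    unfolding c(6) borel_prod[symmetric] by measurable
  have "\<gamma>' \<in> couplings \<mu> \<nu>"
    using c by (simp add: couplings_def \<gamma>'_def prob_space.prob_space_distr[OF c(1) swap] distr_distr[OF _ swap] comp_def)
  moreover have "displacement_norm \<gamma>' = displacement_norm \<gamma>"
    by (simp add: displacement_norm_eq_L2norm \<gamma>'_def L2norm_distr[OF swap]) (simp add: L2norm_def norm_minus_commute)
  ultimately show "W2 \<mu> \<nu> \<le> r" using W2_le \<gamma>(2) by fastforce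
qed

lemma W2_commute: "\<mu> \<in> P2 \<Longrightarrow> \<nu> \<in> P2 \<Longrightarrow> W2 \<mu> \<nu> = W2 \<nu> \<mu>"
  by (intro antisym W2_commute_le)

text \<open>The kernel of \<open>\<gamma>2\<close> over \<open>\<nu>\<close>, attached to the second
  coordinate of \<open>\<gamma>1\<close>, gives a law \<open>\<theta>\<close> of triples (x, y, z)
  whose projections to (x, y) and (y, z) are the given couplings. The glued coupling is the
  projection to (x, z); its displacement is (y - x) + (z - y), to which Minkowski over
  \<open>\<theta>\<close> applies.\<close>

lemma glue_couplings:
  assumes \<mu>: "\<mu> \<in> P2" and \<nu>: "\<nu> \<in> P2" and \<rho>: "\<rho> \<in> P2"
    and \<gamma>1: "\<gamma>1 \<in> couplings \<mu> \<nu>" and \<gamma>2: "\<gamma>2 \<in> couplings \<nu> \<rho>"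
  obtains \<gamma> where "\<gamma> \<in> couplings \<mu> \<rho>"
    "displacement_norm \<gamma> \<le> displacement_norm \<gamma>1 + displacement_norm \<gamma>2"
proof -
  note c1 = couplings_D[OF \<gamma>1] and c2 = couplings_D[OF \<gamma>2]
  obtain \<kappa> where dis: "disintegration \<nu> \<gamma>2 \<kappa>"
    using disintegration_exists[OF c2(1,2)] c2(3) by auto
  then have \<kappa>: "\<kappa> \<in> \<nu> \<rightarrow>\<^sub>M prob_algebra borel" by (simp add: disintegration_def)
  note sets_\<nu> = P2_D(2)[OF \<nu>]
  note \<gamma>2_eq = disintegration_kernel_product[OF dis sets_\<nu> c2(2)]
  have \<kappa>1: "(\<lambda>z. \<kappa> (snd z)) \<in> \<gamma>1 \<rightarrow>\<^sub>M prob_algebra borel"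
    using \<kappa> unfolding c1(6) P2_D(5)[OF \<nu>] by measurable
  define \<theta> where "\<theta> = kernel_product \<gamma>1 (\<lambda>z. \<kappa> (snd z))"
  have sets_\<theta>: "sets \<theta> = sets borel"
    unfolding \<theta>_def by (rule sets_kernel_product[OF c1(2) \<kappa>1])
  have space_\<theta>: "space \<theta> = UNIV" using sets_eq_imp_space_eq[OF sets_\<theta>] by simp
  have meas_\<theta>: "measurable \<theta> N = measurable borel N" for N :: "'z measure"
    using measurable_cong_sets[OF sets_\<theta> refl] .
  have em_\<theta>: "emeasure \<theta> C = (\<integral>\<^sup>+z. emeasure (\<kappa> (snd z)) (Pair z -` C) \<partial>\<gamma>1)" if "C \<in> sets borel" for C
    unfolding \<theta>_def by (rule emeasure_kernel_product[OF c1(2) \<kappa>1 that])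
  define p where "p = (\<lambda>z :: ('a \<times> 'a) \<times> 'a. (snd (fst z), snd z))"
  define q where "q = (\<lambda>z :: ('a \<times> 'a) \<times> 'a. (fst (fst z), snd z))"
  have [measurable]: "p \<in> borel \<rightarrow>\<^sub>M borel" "q \<in> borel \<rightarrow>\<^sub>M borel"
    unfolding p_def q_def by (intro borel_measurable_continuous_onI continuous_intros)+
  have m: "fst \<in> \<theta> \<rightarrow>\<^sub>M borel" "p \<in> \<theta> \<rightarrow>\<^sub>M borel" "q \<in> \<theta> \<rightarrow>\<^sub>M borel"
    unfolding meas_\<theta> by measurable
  have "distr \<theta> borel fst = \<gamma>1"
  proof (rule measure_eqI)
    fix A assume "A \<in> sets (distr \<theta> borel fst)"
    then have A: "A \<in> sets borel" by simp
    then have A': "fst -` A \<in> sets (borel :: (('a \<times> 'a) \<times> 'a) measure)"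
      using measurable_sets[OF borel_measurable_fst_snd(1) A] by simp
    have "emeasure (\<kappa> (snd z)) (Pair z -` fst -` A) = indicator A z" for z
      using prob_space.emeasure_space_1[OF prob_space_kernel[OF sets_\<nu> \<kappa>], of "snd z"]
        sets_eq_imp_space_eq[OF sets_kernel[OF sets_\<nu> \<kappa>], of "snd z"]
      by (cases "z \<in> A") (simp_all add: vimage_def)
    then show "emeasure (distr \<theta> borel fst) A = emeasure \<gamma>1 A"
      using A c1(2) by (simp add: emeasure_distr[OF m(1) A] space_\<theta> em_\<theta>[OF A'])
  qed (simp add: c1(2))
  moreover have "distr \<theta> borel p = \<gamma>2"
  proof (rule measure_eqI)
    fix C assume "C \<in> sets (distr \<theta> borel p)"
    then have C: "C \<in> sets borel" by simp
    have C': "p -` C \<in> sets borel"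
      using measurable_sets[OF \<open>p \<in> borel \<rightarrow>\<^sub>M borel\<close> C] by simp
    have "emeasure (distr \<theta> borel p) C = (\<integral>\<^sup>+z. emeasure (\<kappa> (snd z)) (Pair (snd z) -` C) \<partial>\<gamma>1)"
    proof -
      have "Pair z -` p -` C = Pair (snd z) -` C" for z by (simp add: p_def vimage_def)
      then show ?thesis by (simp add: emeasure_distr[OF m(2) C] space_\<theta> em_\<theta>[OF C'])
    qed
    \<comment> \<open>The integrand depends on \<open>z\<close> only through \<open>snd z\<close>,
      whose law under \<open>\<gamma>1\<close> is \<open>\<nu>\<close>, the base measure of the
      disintegration of \<open>\<gamma>2\<close>.\<close>
    also have "\<dots> = (\<integral>\<^sup>+x. emeasure (\<kappa> x) (Pair x -` C) \<partial>distr \<gamma>1 borel snd)"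
    proof (rule nn_integral_distr[symmetric])
      show "(\<lambda>x. emeasure (\<kappa> x) (Pair x -` C)) \<in> borel_measurable (distr \<gamma>1 borel snd)"
        using borel_measurable_emeasure_kernel[OF sets_\<nu> \<kappa> C] unfolding c1(4) .
    qed (simp add: c1(6))
    also have "\<dots> = emeasure \<gamma>2 C"
      using dis C by (simp add: c1(4) disintegration_def)
    finally show "emeasure (distr \<theta> borel p) C = emeasure \<gamma>2 C" .
  qed (simp add: c2(2))
  ultimately have d1: "distr \<theta> borel fst = \<gamma>1" and d2: "distr \<theta> borel p = \<gamma>2" by simp_all
  have prob_\<theta>: "prob_space \<theta>"
    using c1(1) unfolding d1[symmetric] by (rule prob_space_distrD[OF m(1)])
  define \<gamma> where "\<gamma> = distr \<theta> borel q"
  have "distr \<gamma> borel fst = distr (distr \<theta> borel fst) borel fst"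
    unfolding \<gamma>_def by (simp add: distr_distr[OF _ m(3)] distr_distr[OF _ m(1)]) (simp add: comp_def q_def)
  moreover have "distr \<gamma> borel snd = distr (distr \<theta> borel p) borel snd"
    unfolding \<gamma>_def by (simp add: distr_distr[OF _ m(3)] distr_distr[OF _ m(2)]) (simp add: comp_def q_def p_def)
  ultimately have "\<gamma> \<in> couplings \<mu> \<rho>"
    using prob_space.prob_space_distr[OF prob_\<theta> m(3)] c1 c2 by (simp add: couplings_def d1 d2 \<gamma>_def)
  moreover have "displacement_norm \<gamma> \<le> displacement_norm \<gamma>1 + displacement_norm \<gamma>2"
  proof -
    have 1: "displacement_norm \<gamma>1 = L2norm \<theta> (\<lambda>z. snd (fst z) - fst (fst z))"
      unfolding displacement_norm_eq_L2norm d1[symmetric] by (rule L2norm_distr[OF m(1)]) measurable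
    have 2: "displacement_norm \<gamma>2 = L2norm \<theta> (\<lambda>z. snd z - snd (fst z))"
      unfolding displacement_norm_eq_L2norm d2[symmetric] by (subst L2norm_distr[OF m(2)]) (simp_all add: p_def)
    have 3: "displacement_norm \<gamma> = L2norm \<theta> (\<lambda>z. (snd (fst z) - fst (fst z)) + (snd z - snd (fst z)))"
      unfolding displacement_norm_eq_L2norm \<gamma>_def by (subst L2norm_distr[OF m(3)]) (simp_all add: q_def)
    have 4: "sq_integrable \<theta> (\<lambda>z. snd (fst z) - fst (fst z))"
      using sq_integrable_displacement[OF \<gamma>1 \<mu> \<nu>] unfolding d1[symmetric] by (subst (asm) sq_integrable_distr[OF m(1)]) simp_all
    have 5: "sq_integrable \<theta> (\<lambda>z. snd z - snd (fst z))"
      using sq_integrable_displacement[OF \<gamma>2 \<nu> \<rho>] unfolding d2[symmetric]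
      by (subst (asm) sq_integrable_distr[OF m(2)]) (simp_all add: p_def)
    show ?thesis unfolding 1 2 3 by (rule L2norm_add_le[OF 4 5])
  qed
  ultimately show ?thesis by (rule that)
qed

lemma W2_triangle:
  assumes "\<mu> \<in> P2" "\<nu> \<in> P2" "\<rho> \<in> P2"
  shows "W2 \<mu> \<rho> \<le> W2 \<mu> \<nu> + W2 \<nu> \<rho>"
proof (rule field_le_epsilon)
  fix e :: real assume "e > 0"
  obtain \<gamma>1 where 1: "\<gamma>1 \<in> couplings \<mu> \<nu>" "displacement_norm \<gamma>1 < W2 \<mu> \<nu> + e / 2"
    using W2_lessE[OF assms(1,2), of "W2 \<mu> \<nu> + e / 2"] \<open>e > 0\<close> by auto
  obtain \<gamma>2 where 2: "\<gamma>2 \<in> couplings \<nu> \<rho>" "displacement_norm \<gamma>2 < W2 \<nu> \<rho> + e / 2"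
    using W2_lessE[OF assms(2,3), of "W2 \<nu> \<rho> + e / 2"] \<open>e > 0\<close> by auto
  obtain \<gamma> where "\<gamma> \<in> couplings \<mu> \<rho>" "displacement_norm \<gamma> \<le> displacement_norm \<gamma>1 + displacement_norm \<gamma>2"
    by (rule glue_couplings[OF assms 1(1) 2(1)])
  then show "W2 \<mu> \<rho> \<le> W2 \<mu> \<nu> + W2 \<nu> \<rho> + e" using W2_le[of \<gamma> \<mu> \<rho>] 1(2) 2(2) by linarith
qed

section \<open>Maps of linear growth\<close>

lemma C1_maps_bound:
  assumes "w \<in> C1_maps"
  obtains C where "C > 0" "\<And>x. norm (w x) \<le> C * (1 + norm x)"
proof -
  obtain B where B: "\<And>x. norm (w x) / (1 + norm x) \<le> B"
    using assms by (auto simp: C1_maps_def bdd_above_def)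
  \<comment> \<open>The maximum with 1 makes the constant positive, so that it can be divided by
    later.\<close>
  have "norm (w x) \<le> max 1 B * (1 + norm x)" for x
  proof -
    have "0 < 1 + norm x" by (simp add: add_pos_nonneg)
    then have "norm (w x) \<le> B * (1 + norm x)" using B[of x] by (simp add: pos_divide_le_eq)
    also have "\<dots> \<le> max 1 B * (1 + norm x)" by (intro mult_right_mono) auto
    finally show ?thesis .
  qed
  then show ?thesis by (intro that[of "max 1 B"]) auto
qed

lemma C1_maps_measurable: "w \<in> C1_maps \<Longrightarrow> w \<in> borel_measurable borel"
  by (simp add: C1_maps_def borel_measurable_continuous_onI)

lemma C1_maps_sq_integrable:
  assumes w: "w \<in> C1_maps" and \<mu>: "\<mu> \<in> P2"
  shows "sq_integrable \<mu> w"
proof -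
  interpret prob_space \<mu> using P2_D[OF \<mu>] by simp
  obtain C where C: "C > 0" "\<And>x. norm (w x) \<le> C * (1 + norm x)" using C1_maps_bound[OF w] by metis
  show ?thesis
  proof (rule sq_integrable_bound)
    show "integrable \<mu> (\<lambda>x. C\<^sup>2 * (2 + 2 * (norm x)\<^sup>2))"
      using P2_D(4)[OF \<mu>] by (simp add: sq_integrable_def)
    show "(norm (w x))\<^sup>2 \<le> C\<^sup>2 * (2 + 2 * (norm x)\<^sup>2)" for x
    proof -
      have "(norm (w x))\<^sup>2 \<le> (C * (1 + norm x))\<^sup>2" by (intro power_mono C norm_ge_zero)
      also have "\<dots> = C\<^sup>2 * (1 + norm x)\<^sup>2" by (rule power_mult_distrib)
      also have "(1 + norm x)\<^sup>2 \<le> 2 + 2 * (norm x)\<^sup>2"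
        using norm_add_power2_le[of 1 "norm x"] by simp
      finally show ?thesis by (simp add: mult_left_mono)
    qed
    show "w \<in> borel_measurable \<mu>"
      using C1_maps_measurable[OF w] unfolding P2_D(5)[OF \<mu>] .
  qed
qed

lemma tail_integral_small:
  fixes \<mu> :: "'a::euclidean_space measure" and g :: "'a \<Rightarrow> real"
  assumes g: "integrable \<mu> g" and s: "sets \<mu> = sets borel" and "e > 0"
  obtains R :: nat where "\<bar>\<integral>x. g x * indicator {x :: 'a. norm x > real R} x \<partial>\<mu>\<bar> < e"
proof -
  have [measurable]: "{x :: 'a. norm x > r} \<in> sets \<mu>" for r :: real
    unfolding s by measurable
  have gm: "g \<in> borel_measurable \<mu>" by (rule borel_measurable_integrable[OF g])
  have lim: "(\<lambda>n. \<integral>x. g x * indicator {x :: 'a. norm x > real n} x \<partial>\<mu>) \<longlonglongrightarrow> (\<integral>x. 0 \<partial>\<mu>)"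
  proof (rule integral_dominated_convergence[where w = "\<lambda>x. norm (g x)"])
    show "AE x in \<mu>. (\<lambda>n. g x * indicator {x :: 'a. norm x > real n} x) \<longlonglongrightarrow> 0"
    proof (rule AE_I2)
      fix x :: 'a
      obtain N :: nat where N: "norm x \<le> real N" using real_arch_simple by blast
      have "\<forall>\<^sub>F n in sequentially. g x * indicator {x :: 'a. norm x > real n} x = 0"
        using eventually_ge_at_top[of N] by eventually_elim (use N in \<open>auto simp: indicator_def\<close>)
      then show "(\<lambda>n. g x * indicator {x :: 'a. norm x > real n} x) \<longlonglongrightarrow> 0" by (rule tendsto_eventually)
    qed
    show "(\<lambda>x. g x * indicator {x :: 'a. norm x > real n} x) \<in> borel_measurable \<mu>" for n
      by (intro borel_measurable_times gm borel_measurable_indicator) simp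
    show "AE x in \<mu>. norm (g x * indicator {x :: 'a. norm x > real n} x) \<le> norm (g x)" for n
      by (auto simp: indicator_def)
  qed (use g in auto)
  then have "\<forall>\<^sub>F n in sequentially. \<bar>\<integral>x. g x * indicator {x :: 'a. norm x > real n} x \<partial>\<mu>\<bar> < e"
    using tendstoD[OF lim \<open>e > 0\<close>] by (simp add: dist_real_def)
  then show ?thesis using that by (auto simp: eventually_sequentially)
qed

text \<open>The growth of \<open>w\<close> is controlled by the tail of \<open>\<mu>\<close> where \<open>x\<close> is large, by the displacement
  where \<open>y\<close> is far from \<open>x\<close>, and by uniform continuity elsewhere.\<close>

lemma C1_maps_increment_bound:
  fixes w :: "'a::euclidean_space \<Rightarrow> 'a"
  assumes w: "continuous_on UNIV w" and C: "C > 0" "\<And>x. norm (w x) \<le> C * (1 + norm x)" and "e > 0"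
  obtains K where "K > 0" "\<And>x y. (norm (w y - w x))\<^sup>2 \<le>
    e + 12 * C\<^sup>2 * ((1 + (norm x)\<^sup>2) * indicator {x. norm x > real R} x) + K * (norm (y - x))\<^sup>2"
proof -
  have "uniformly_continuous_on (cball 0 (real R + 1)) w"
    by (intro compact_uniformly_continuous compact_cball continuous_on_subset[OF w]) simp
  moreover have "sqrt e > 0" using \<open>e > 0\<close> by simp
  ultimately obtain d' where d': "d' > 0" "\<And>x y. x \<in> cball 0 (real R + 1) \<Longrightarrow> y \<in> cball 0 (real R + 1) \<Longrightarrow>
      dist y x < d' \<Longrightarrow> dist (w y) (w x) < sqrt e"
    unfolding uniformly_continuous_on_def by meson
  \<comment> \<open>A step shorter than 1 from the ball of radius \<open>R\<close> stays in the ball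
    of radius \<open>R + 1\<close>, on which uniform continuity was obtained.\<close>
  define d where "d = min 1 d'"
  have d: "d > 0" "d \<le> 1" "d \<le> d'" using d' by (auto simp: d_def)
  \<comment> \<open>The term \<open>(4 + 4 * (real R)\<^sup>2) / d\<^sup>2\<close> covers long jumps
    from inside the ball, where \<open>1 \<le> (norm (y - x))\<^sup>2 / d\<^sup>2\<close>; the
    \<open>+ 1\<close> absorbs the displacement term of the general estimate
    \<open>gen\<close>.\<close>
  define K where "K = 3 * C\<^sup>2 * ((4 + 4 * (real R)\<^sup>2) / d\<^sup>2 + 1)"
  have K: "K \<ge> 3 * C\<^sup>2" using C by (simp add: K_def)
  moreover have "0 < 3 * C\<^sup>2" using C by simp
  ultimately have K0: "K > 0" by linarith
  have "(norm (w y - w x))\<^sup>2 \<le>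
    e + 12 * C\<^sup>2 * ((1 + (norm x)\<^sup>2) * indicator {x. norm x > real R} x) + K * (norm (y - x))\<^sup>2" for x y
  proof -
    have K': "3 * C\<^sup>2 * (norm (y - x))\<^sup>2 \<le> K * (norm (y - x))\<^sup>2" using K by (rule mult_right_mono) simp
    \<comment> \<open>The constants come from \<open>(a + b + c)\<^sup>2 \<le> 3 * (a\<^sup>2 +
      b\<^sup>2 + c\<^sup>2)\<close> with \<open>a = 2\<close>, \<open>b = 2 * norm x\<close> and
      \<open>c = norm (y - x)\<close>, times \<open>C\<^sup>2\<close>.\<close>
    have gen: "(norm (w y - w x))\<^sup>2 \<le> 12 * C\<^sup>2 * (1 + (norm x)\<^sup>2) + 3 * C\<^sup>2 * (norm (y - x))\<^sup>2"
    proof -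
      have "norm (w y - w x) \<le> norm (w y) + norm (w x)" by (rule norm_triangle_ineq4)
      also have "\<dots> \<le> C * (1 + norm y) + C * (1 + norm x)" by (intro add_mono C)
      also have "\<dots> = C * ((1 + norm y) + (1 + norm x))" by (rule distrib_left[symmetric])
      also have "\<dots> \<le> C * (2 + 2 * norm x + norm (y - x))"
        using norm_triangle_sub[of y x] C(1) by (intro mult_left_mono) simp_all
      finally have "(norm (w y - w x))\<^sup>2 \<le> (C * (2 + 2 * norm x + norm (y - x)))\<^sup>2"
        by (rule power_mono) simp
      also have "\<dots> = C\<^sup>2 * (2 + 2 * norm x + norm (y - x))\<^sup>2" by (rule power_mult_distrib)
      also have "C\<^sup>2 * (2 + 2 * norm x + norm (y - x))\<^sup>2 \<le> C\<^sup>2 * (3 * (4 + 4 * (norm x)\<^sup>2 + (norm (y - x))\<^sup>2))"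
      proof (intro mult_left_mono zero_le_power2)
        show "(2 + 2 * norm x + norm (y - x))\<^sup>2 \<le> 3 * (4 + 4 * (norm x)\<^sup>2 + (norm (y - x))\<^sup>2)"
          using zero_le_power2[of "2 - 2 * norm x"] zero_le_power2[of "2 - norm (y - x)"]
            zero_le_power2[of "2 * norm x - norm (y - x)"]
          by (simp add: power2_eq_square algebra_simps)
      qed
      finally show ?thesis by (simp add: algebra_simps)
    qed
    consider "norm x > real R" | "norm x \<le> real R" "norm (y - x) \<ge> d" | "norm x \<le> real R" "norm (y - x) < d"
      by linarith
    then show ?thesis
    proof cases
      case 1
      then show ?thesis using gen K' \<open>e > 0\<close> by (simp add: indicator_def)
    next
      case 2
      have "(norm x)\<^sup>2 \<le> (real R)\<^sup>2" using 2 by (intro power_mono) auto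
      then have "12 * C\<^sup>2 * (1 + (norm x)\<^sup>2) \<le> 12 * C\<^sup>2 * (1 + (real R)\<^sup>2)" by (intro mult_left_mono) auto
      also have "\<dots> \<le> 12 * C\<^sup>2 * (1 + (real R)\<^sup>2) * ((norm (y - x))\<^sup>2 / d\<^sup>2)"
      proof -
        have "1 \<le> (norm (y - x))\<^sup>2 / d\<^sup>2" using 2 d by (simp add: power_mono)
        from mult_left_mono[OF this, of "12 * C\<^sup>2 * (1 + (real R)\<^sup>2)"] show ?thesis by simp
      qed
      finally have "12 * C\<^sup>2 * (1 + (norm x)\<^sup>2) + 3 * C\<^sup>2 * (norm (y - x))\<^sup>2 \<le> K * (norm (y - x))\<^sup>2"
        by (simp add: K_def field_simps)
      then show ?thesis using gen 2 \<open>e > 0\<close> by (simp add: indicator_def)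
    next
      case 3
      have "norm y \<le> real R + 1" using norm_triangle_sub[of y x] 3 d by linarith
      then have "dist (w y) (w x) < sqrt e" using 3 d by (intro d'(2)) (auto simp: dist_norm)
      then have "(norm (w y - w x))\<^sup>2 \<le> (sqrt e)\<^sup>2" by (intro power_mono) (auto simp: dist_norm)
      moreover have "0 \<le> K * (norm (y - x))\<^sup>2" using K0 by simp
      ultimately show ?thesis using 3 \<open>e > 0\<close> by (simp add: indicator_def)
    qed
  qed
  with K0 show ?thesis by (rule that)
qed

text \<open>The tail in the pointwise estimate involves only \<open>x\<close>, so it integrates
  against \<open>\<mu>\<close>, and one \<open>\<delta>\<close> serves all \<open>\<nu>\<close> and
  all couplings at once. A choice of \<open>R\<close> makes the tail small and determines
  \<open>K\<close>; then \<open>\<delta> = sqrt (e / K)\<close> makes the displacement term at most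
  \<open>e\<close>. Three terms of size \<open>e\<close> explain
  \<open>e = \<epsilon>\<^sup>2 / 3\<close>.\<close>

lemma C1_maps_increment_small:
  fixes w :: "'a::euclidean_space \<Rightarrow> 'a"
  assumes w: "w \<in> C1_maps" and \<mu>: "\<mu> \<in> P2" and "\<epsilon> > 0"
  obtains \<delta> where "\<delta> > 0"
    "\<And>\<nu> \<gamma>. \<nu> \<in> P2 \<Longrightarrow> \<gamma> \<in> couplings \<mu> \<nu> \<Longrightarrow> displacement_norm \<gamma> < \<delta> \<Longrightarrow>
      L2norm \<gamma> (\<lambda>z. w (snd z) - w (fst z)) \<le> \<epsilon>"
proof -
  obtain C where C: "C > 0" "\<And>x. norm (w x) \<le> C * (1 + norm x)" using C1_maps_bound[OF w] by metis
  define e where "e = \<epsilon>\<^sup>2 / 3"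
  have e: "e > 0" using \<open>\<epsilon> > 0\<close> by (simp add: e_def)
  interpret \<mu>: prob_space \<mu> using P2_D[OF \<mu>] by simp
  define g where "g = (\<lambda>x :: 'a. 1 + (norm x)\<^sup>2)"
  have g: "integrable \<mu> g" using P2_D(4)[OF \<mu>] by (simp add: sq_integrable_def g_def)
  have [measurable]: "g \<in> borel_measurable borel" unfolding g_def by measurable
  obtain R where R: "\<bar>\<integral>x. g x * indicator {x. norm x > real R} x \<partial>\<mu>\<bar> < e / (12 * C\<^sup>2)"
    using tail_integral_small[OF g P2_D(2)[OF \<mu>], of "e / (12 * C\<^sup>2)"] e C(1) by auto
  define h where "h = (\<lambda>x. g x * indicator {x. norm x > real R} x)"
  have hm[measurable]: "h \<in> borel_measurable borel"
    unfolding h_def by measurable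
  have h: "integrable \<mu> h"
    by (rule Bochner_Integration.integrable_bound[OF g]) (auto simp: h_def indicator_def P2_D(5)[OF \<mu>] intro!: hm[unfolded h_def])
  obtain K where K: "K > 0" "\<And>x y. (norm (w y - w x))\<^sup>2 \<le> e + 12 * C\<^sup>2 * h x + K * (norm (y - x))\<^sup>2"
  proof (rule C1_maps_increment_bound[OF _ C e, of R])
    show "continuous_on UNIV w" using w by (simp add: C1_maps_def)
  qed (simp_all add: that h_def g_def)
  show ?thesis
  proof (rule that[of "sqrt (e / K)"])
    show "0 < sqrt (e / K)" using e K by simp
    fix \<nu> \<gamma> assume \<nu>: "\<nu> \<in> P2" and \<gamma>: "\<gamma> \<in> couplings \<mu> \<nu>" and small: "displacement_norm \<gamma> < sqrt (e / K)"
    note c = couplings_D[OF \<gamma>]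
    interpret prob_space \<gamma> by (rule c)
    have f: "fst \<in> \<gamma> \<rightarrow>\<^sub>M borel" unfolding c(6) by measurable
    have disp: "integrable \<gamma> (\<lambda>z. (norm (snd z - fst z))\<^sup>2)"
      using sq_integrable_displacement[OF \<gamma> \<mu> \<nu>] by (simp add: sq_integrable_def)
    have hf: "integrable \<gamma> (\<lambda>z. h (fst z))" "(\<integral>z. h (fst z) \<partial>\<gamma>) = (\<integral>x. h x \<partial>\<mu>)"
      using h integrable_distr_eq[OF f hm] integral_distr[OF f hm] by (simp_all add: c(3))
    have wi: "sq_integrable \<gamma> (\<lambda>z. w (snd z) - w (fst z))"
      using couplings_transfer[OF \<gamma> C1_maps_measurable[OF w]] C1_maps_sq_integrable[OF w] \<mu> \<nu>
      by (intro sq_integrable_diff) simp_all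
    have "(L2norm \<gamma> (\<lambda>z. w (snd z) - w (fst z)))\<^sup>2
        \<le> (\<integral>z. e + 12 * C\<^sup>2 * h (fst z) + K * (norm (snd z - fst z))\<^sup>2 \<partial>\<gamma>)"
      unfolding L2norm_power2 using wi hf disp K(2)
      by (intro integral_mono) (simp_all add: sq_integrable_def)
    also have "\<dots> = e + 12 * C\<^sup>2 * (\<integral>x. h x \<partial>\<mu>) + K * (displacement_norm \<gamma>)\<^sup>2"
      using hf disp prob_space by (simp add: displacement_norm_def)
    also have "\<dots> \<le> e + e + e"
    proof (intro add_mono order_refl)
      have "(\<integral>x. h x \<partial>\<mu>) \<le> e / (12 * C\<^sup>2)" using R by (simp add: h_def abs_less_iff)
      then show "12 * C\<^sup>2 * (\<integral>x. h x \<partial>\<mu>) \<le> e" using C(1) by (simp add: field_simps)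
      have "(displacement_norm \<gamma>)\<^sup>2 \<le> (sqrt (e / K))\<^sup>2"
        using small by (intro power_mono) (auto simp: displacement_norm_def)
      then show "K * (displacement_norm \<gamma>)\<^sup>2 \<le> e" using K e by (simp add: field_simps)
    qed
    also have "\<dots> = \<epsilon>\<^sup>2" by (simp add: e_def)
    finally show "L2norm \<gamma> (\<lambda>z. w (snd z) - w (fst z)) \<le> \<epsilon>"
      by (rule power2_le_imp_le) (use \<open>\<epsilon> > 0\<close> in simp)
  qed
qed

section \<open>Density of the linear-growth maps among square-integrable maps\<close>

lemma C1_maps_add: "v \<in> C1_maps \<Longrightarrow> w \<in> C1_maps \<Longrightarrow> (\<lambda>x. v x + w x) \<in> C1_maps"
proof -
  assume v: "v \<in> C1_maps" and w: "w \<in> C1_maps"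
  obtain A where A: "A > 0" "\<And>x. norm (v x) \<le> A * (1 + norm x)" using C1_maps_bound[OF v] by metis
  obtain B where B: "B > 0" "\<And>x. norm (w x) \<le> B * (1 + norm x)" using C1_maps_bound[OF w] by metis
  have "norm (v x + w x) / (1 + norm x) \<le> A + B" for x
  proof -
    have "norm (v x + w x) \<le> (A + B) * (1 + norm x)"
      using norm_triangle_ineq[of "v x" "w x"] A(2)[of x] B(2)[of x] by (simp add: distrib_right)
    then show ?thesis by (simp add: pos_divide_le_eq add_pos_nonneg)
  qed
  then show ?thesis
    using v w by (auto simp: C1_maps_def bdd_above_def intro!: continuous_intros)
qed

lemma C1_maps_scaleR: "w \<in> C1_maps \<Longrightarrow> (\<lambda>x. c *\<^sub>R w x) \<in> C1_maps"
proof -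
  assume w: "w \<in> C1_maps"
  obtain B where B: "B > 0" "\<And>x. norm (w x) \<le> B * (1 + norm x)" using C1_maps_bound[OF w] by metis
  have "norm (c *\<^sub>R w x) / (1 + norm x) \<le> \<bar>c\<bar> * B" for x
    using mult_left_mono[OF B(2)[of x], of "\<bar>c\<bar>"]
    by (simp add: pos_divide_le_eq add_pos_nonneg mult.assoc)
  then show ?thesis
    using w by (auto simp: C1_maps_def bdd_above_def intro!: continuous_intros)
qed

lemma C1_maps_bounded:
  assumes "continuous_on UNIV w" "\<And>x. norm (w x) \<le> B"
  shows "w \<in> C1_maps"
proof -
  have "norm (w x) / (1 + norm x) \<le> B" for x
  proof -
    have "norm (w x) \<le> norm (w x) * (1 + norm x)" by (simp add: distrib_left)
    then have "norm (w x) / (1 + norm x) \<le> norm (w x)" by (simp add: pos_divide_le_eq add_pos_nonneg)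
    then show ?thesis using assms(2)[of x] by simp
  qed
  then show ?thesis using assms(1) by (auto simp: C1_maps_def bdd_above_def)
qed

text \<open>Density phrased as a property of one \<open>f\<close>, so that it can be propagated by
  induction over measurable functions.\<close>

definition C1_approximable :: "'a::euclidean_space measure \<Rightarrow> ('a \<Rightarrow> 'a) \<Rightarrow> bool" where
  "C1_approximable \<mu> f \<longleftrightarrow> (\<forall>e>0. \<exists>w\<in>C1_maps. L2norm \<mu> (\<lambda>x. f x - w x) < e)"

context
  fixes \<mu> :: "'a::euclidean_space measure"
  assumes \<mu>: "\<mu> \<in> P2"
begin

lemma C1_approximable_add:
  assumes f: "sq_integrable \<mu> f" "C1_approximable \<mu> f" and g: "sq_integrable \<mu> g" "C1_approximable \<mu> g"
  shows "C1_approximable \<mu> (\<lambda>x. f x + g x)"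
  unfolding C1_approximable_def
proof (intro allI impI)
  fix e :: real assume "e > 0"
  obtain v where v: "v \<in> C1_maps" "L2norm \<mu> (\<lambda>x. f x - v x) < e / 2"
    using f(2) \<open>e > 0\<close> unfolding C1_approximable_def by (meson half_gt_zero)
  obtain w where w: "w \<in> C1_maps" "L2norm \<mu> (\<lambda>x. g x - w x) < e / 2"
    using g(2) \<open>e > 0\<close> unfolding C1_approximable_def by (meson half_gt_zero)
  have "L2norm \<mu> (\<lambda>x. (f x - v x) + (g x - w x)) < e"
    using L2norm_add_le[OF sq_integrable_diff[OF f(1) C1_maps_sq_integrable[OF v(1) \<mu>]]
        sq_integrable_diff[OF g(1) C1_maps_sq_integrable[OF w(1) \<mu>]]] v(2) w(2) by linarith
  then have "L2norm \<mu> (\<lambda>x. (f x + g x) - (v x + w x)) < e"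
    by (simp add: algebra_simps)
  then show "\<exists>w\<in>C1_maps. L2norm \<mu> (\<lambda>x. (f x + g x) - w x) < e"
    using C1_maps_add[OF v(1) w(1)] by (intro bexI)
qed

lemma C1_approximable_scaleR:
  assumes "C1_approximable \<mu> f"
  shows "C1_approximable \<mu> (\<lambda>x. c *\<^sub>R f x)"
  unfolding C1_approximable_def
proof (intro allI impI)
  fix e :: real assume "e > 0"
  then have "e / (\<bar>c\<bar> + 1) > 0" by (simp add: add_nonneg_pos)
  then obtain w where w: "w \<in> C1_maps" "L2norm \<mu> (\<lambda>x. f x - w x) < e / (\<bar>c\<bar> + 1)"
    using assms unfolding C1_approximable_def by blast
  have "L2norm \<mu> (\<lambda>x. c *\<^sub>R f x - c *\<^sub>R w x) = \<bar>c\<bar> * L2norm \<mu> (\<lambda>x. f x - w x)"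
    by (simp add: L2norm_def scaleR_diff_right[symmetric] power_mult_distrib real_sqrt_mult)
  also have "\<dots> \<le> (\<bar>c\<bar> + 1) * L2norm \<mu> (\<lambda>x. f x - w x)"
    by (intro mult_right_mono L2norm_nonneg) simp
  also have "\<dots> < e" using w(2) by (simp add: field_simps)
  finally show "\<exists>w\<in>C1_maps. L2norm \<mu> (\<lambda>x. c *\<^sub>R f x - w x) < e"
    using C1_maps_scaleR[OF w(1), of c] by (intro bexI)
qed

lemma C1_approximable_limit:
  assumes "sq_integrable \<mu> f" "\<And>i. sq_integrable \<mu> (F i)" "\<And>i. C1_approximable \<mu> (F i)"
    and lim: "(\<lambda>i. L2norm \<mu> (\<lambda>x. f x - F i x)) \<longlonglongrightarrow> 0"
  shows "C1_approximable \<mu> f"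
  unfolding C1_approximable_def
proof (intro allI impI)
  fix e :: real assume "e > 0"
  then have "\<forall>\<^sub>F i in sequentially. L2norm \<mu> (\<lambda>x. f x - F i x) < e / 2"
    by (intro order_tendstoD(2)[OF lim]) simp
  then obtain i where i: "L2norm \<mu> (\<lambda>x. f x - F i x) < e / 2" by (auto simp: eventually_sequentially)
  obtain w where w: "w \<in> C1_maps" "L2norm \<mu> (\<lambda>x. F i x - w x) < e / 2"
    using assms(3)[of i] \<open>e > 0\<close> unfolding C1_approximable_def by (meson half_gt_zero)
  have "L2norm \<mu> (\<lambda>x. (f x - F i x) + (F i x - w x)) < e"
    using L2norm_add_le[OF sq_integrable_diff[OF assms(1,2)]
        sq_integrable_diff[OF assms(2) C1_maps_sq_integrable[OF w(1) \<mu>]], of i i] i w(2) by linarith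
  then show "\<exists>w\<in>C1_maps. L2norm \<mu> (\<lambda>x. f x - w x) < e"
    using w(1) by (intro bexI) simp_all
qed

text \<open>Regularity encloses \<open>A\<close> between a compact \<open>K\<close> and an open
  \<open>U\<close> with \<open>U - K\<close> of small measure; a Urysohn function equal to 1 on
  \<open>K\<close> and 0 off \<open>U\<close> differs from the indicator only on
  \<open>U - K\<close>, by at most 1.\<close>

lemma C1_approximable_indicator:
  assumes A: "A \<in> sets borel"
  shows "C1_approximable \<mu> (\<lambda>x. indicator A x *\<^sub>R b)"
  unfolding C1_approximable_def
proof (intro allI impI)
  fix e :: real assume e: "e > 0"
  interpret finite_measure \<mu> using P2_D(1)[OF \<mu>] by (simp add: prob_space.finite_measure)
  \<comment> \<open>Chosen so that \<open>(norm b)\<^sup>2 * (2 * d) < e\<^sup>2\<close>, where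
    \<open>2 * d\<close> will bound the measure of \<open>U - K\<close>; the \<open>+ 1\<close>
    covers \<open>b = 0\<close>.\<close>
  define d where "d = e\<^sup>2 / (2 * ((norm b)\<^sup>2 + 1))"
  have nb: "0 < (norm b)\<^sup>2 + 1" by (simp add: add_nonneg_pos)
  have d: "d > 0" using e nb by (simp add: d_def)
  have fin: "emeasure \<mu> (space \<mu>) \<noteq> \<infinity>" by simp
  have [simp]: "sets \<mu> = sets borel" by (rule P2_D(2)[OF \<mu>])
  have "\<exists>K. compact K \<and> K \<subseteq> A \<and> measure \<mu> A - d < measure \<mu> K"
  proof (rule ccontr)
    assume *: "\<not> (\<exists>K. compact K \<and> K \<subseteq> A \<and> measure \<mu> A - d < measure \<mu> K)"
    have le: "measure \<mu> K \<le> measure \<mu> A - d" if "compact K" "K \<subseteq> A" for K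
      using * that by (auto simp: not_less)
    have "emeasure \<mu> A \<le> ennreal (measure \<mu> A - d)"
      unfolding inner_regular[OF P2_D(2)[OF \<mu>] fin A]
      by (rule SUP_least) (auto simp: emeasure_eq_measure intro!: ennreal_leI le)
    moreover have "0 \<le> measure \<mu> A - d" using le[of "{}"] by simp
    ultimately show False using d by (simp add: emeasure_eq_measure)
  qed
  then obtain K where K: "compact K" "K \<subseteq> A" "measure \<mu> A - d < measure \<mu> K" by blast
  have "\<exists>U. open U \<and> A \<subseteq> U \<and> measure \<mu> U < measure \<mu> A + d"
  proof (rule ccontr)
    assume *: "\<not> (\<exists>U. open U \<and> A \<subseteq> U \<and> measure \<mu> U < measure \<mu> A + d)"
    have le: "measure \<mu> A + d \<le> measure \<mu> U" if "open U" "A \<subseteq> U" for U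
      using * that by (auto simp: not_less)
    have "ennreal (measure \<mu> A + d) \<le> emeasure \<mu> A"
      unfolding outer_regular[OF P2_D(2)[OF \<mu>] fin A]
      by (rule INF_greatest) (auto simp: emeasure_eq_measure intro!: ennreal_leI le)
    then show False using d by (simp add: emeasure_eq_measure)
  qed
  then obtain U where U: "open U" "A \<subseteq> U" "measure \<mu> U < measure \<mu> A + d" by blast
  have "closed K" "K \<in> sets borel" "U \<in> sets borel"
    using K(1) U(1) by (auto simp: compact_imp_closed)
  obtain g :: "'a \<Rightarrow> real" where g: "continuous_on UNIV g" "\<And>x. g x \<in> closed_segment 1 0"
      "\<And>x. x \<in> K \<Longrightarrow> g x = 1" "\<And>x. x \<in> - U \<Longrightarrow> g x = 0"
    by (rule Urysohn[OF \<open>closed K\<close> closed_Compl[OF U(1)], where a = 1 and b = "0 :: real"])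
      (use K U in auto)
  have g01: "0 \<le> g x" "g x \<le> 1" for x using g(2)[of x] by (auto simp: closed_segment_eq_real_ivl)
  have w: "(\<lambda>x. g x *\<^sub>R b) \<in> C1_maps"
    using g01 by (intro C1_maps_bounded[where B = "norm b"] continuous_intros g(1)) (simp add: mult_left_le_one_le)
  have "(L2norm \<mu> (\<lambda>x. indicator A x *\<^sub>R b - g x *\<^sub>R b))\<^sup>2 \<le> (\<integral>x. (norm b)\<^sup>2 * indicator (U - K) x \<partial>\<mu>)"
    unfolding L2norm_power2
  proof (rule integral_mono')
    show "(norm (indicator A x *\<^sub>R b - g x *\<^sub>R b))\<^sup>2 \<le> (norm b)\<^sup>2 * indicator (U - K) x" for x
    proof -
      have "\<bar>indicator A x - g x\<bar> \<le> indicator (U - K) x"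
        using K(2) U(2) g(3,4)[of x] g01[of x] by (auto simp: indicator_def)
      then have "\<bar>indicator A x - g x\<bar> * norm b \<le> indicator (U - K) x * norm b"
        by (rule mult_right_mono) simp
      then have "(\<bar>indicator A x - g x\<bar> * norm b)\<^sup>2 \<le> (indicator (U - K) x * norm b)\<^sup>2"
        by (rule power_mono) simp
      also have "\<dots> = (norm b)\<^sup>2 * indicator (U - K) x" by (simp add: indicator_def)
      finally show ?thesis by (simp add: scaleR_diff_left[symmetric] del: indicator_diff)
    qed
    show "integrable \<mu> (\<lambda>x. (norm b)\<^sup>2 * indicator (U - K) x)"
      using \<open>K \<in> sets borel\<close> \<open>U \<in> sets borel\<close> by (simp add: emeasure_eq_measure)
  qed simp
  also have "\<dots> = (norm b)\<^sup>2 * measure \<mu> (U - K)"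
    using \<open>K \<in> sets borel\<close> \<open>U \<in> sets borel\<close> by (simp add: P2_D(3)[OF \<mu>])
  also have "\<dots> \<le> (norm b)\<^sup>2 * (2 * d)"
  proof (rule mult_left_mono)
    have "measure \<mu> (U - K) = measure \<mu> U - measure \<mu> K"
      using K(2) U(2) \<open>K \<in> sets borel\<close> \<open>U \<in> sets borel\<close> by (intro finite_measure_Diff) auto
    then show "measure \<mu> (U - K) \<le> 2 * d" using K(3) U(3) by simp
  qed simp
  also have "\<dots> < e\<^sup>2"
    using nb e by (simp add: d_def field_simps)
  finally have "L2norm \<mu> (\<lambda>x. indicator A x *\<^sub>R b - g x *\<^sub>R b) < e"
    by (rule power2_less_imp_less) (use e in simp)
  then show "\<exists>w\<in>C1_maps. L2norm \<mu> (\<lambda>x. indicator A x *\<^sub>R b - w x) < e"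
    using w by (rule bexI)
qed

text \<open>Induction over nonnegative measurable functions, with square integrability as a premise
  in every case: the pieces of a sum and the members of an increasing sequence inherit it by
  domination (\<open>dom\<close>), and dominated convergence turns pointwise convergence into
  convergence of \<open>L2norm\<close>.\<close>

lemma C1_approximable_nonneg:
  assumes u: "u \<in> borel_measurable \<mu>" "\<And>x. 0 \<le> u x" and "b \<in> Basis"
    and sq: "sq_integrable \<mu> (\<lambda>x. u x *\<^sub>R b)"
  shows "C1_approximable \<mu> (\<lambda>x. u x *\<^sub>R b)"
  using u sq
proof (induction rule: borel_measurable_induct_real)
  have dom: "sq_integrable \<mu> (\<lambda>x. v x *\<^sub>R b)"
    if "sq_integrable \<mu> (\<lambda>x. u x *\<^sub>R b)" "v \<in> borel_measurable \<mu>" "\<And>x. 0 \<le> v x" "\<And>x. v x \<le> u x" for u v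
  proof (rule sq_integrable_bound)
    show "integrable \<mu> (\<lambda>x. (norm (u x *\<^sub>R b))\<^sup>2)" using that by (simp add: sq_integrable_def)
    show "(norm (v x *\<^sub>R b))\<^sup>2 \<le> (norm (u x *\<^sub>R b))\<^sup>2" for x
      using that(3,4)[of x] by (intro power_mono) (auto simp: intro!: mult_right_mono)
  qed (use that in simp)
  {
    case (set A)
    then show ?case using C1_approximable_indicator P2_D(2)[OF \<mu>] by simp
  next
    case (mult u c)
    \<comment> \<open>For \<open>c = 0\<close> nothing about \<open>u\<close> follows from square
      integrability of the product, but the map is then zero.\<close>
    show ?case
    proof (cases "c = 0")
      case True
      then show ?thesis using C1_approximable_indicator[of "{}" b] by simp
    next
      case False
      then have "sq_integrable \<mu> (\<lambda>x. u x *\<^sub>R b)"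
        using sq_integrable_scaleR[OF mult.prems, of "1 / c"] by simp
      then show ?thesis using C1_approximable_scaleR[OF mult.IH, of c] by simp
    qed
  next
    case (add u v)
    have "sq_integrable \<mu> (\<lambda>x. u x *\<^sub>R b)" "sq_integrable \<mu> (\<lambda>x. v x *\<^sub>R b)"
      using add.hyps by (auto intro!: dom[OF add.prems])
    then show ?case
      using C1_approximable_add[of "\<lambda>x. v x *\<^sub>R b" "\<lambda>x. u x *\<^sub>R b"] add.IH by (simp add: scaleR_add_left)
  next
    case (seq U)
    have le: "U i x \<le> u x" for i x
    proof (rule LIMSEQ_le_const)
      show "(\<lambda>i. U i x) \<longlonglongrightarrow> u x" using seq.hyps by (simp add: P2_D(3)[OF \<mu>])
      show "\<exists>N. \<forall>n\<ge>N. U i x \<le> U n x" using \<open>incseq U\<close> by (auto simp: incseq_def le_fun_def)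
    qed
    have sqU: "sq_integrable \<mu> (\<lambda>x. U i x *\<^sub>R b)" for i
      using seq.hyps le by (intro dom[OF seq.prems]) auto
    have "(\<lambda>i. \<integral>x. (norm (u x *\<^sub>R b - U i x *\<^sub>R b))\<^sup>2 \<partial>\<mu>) \<longlonglongrightarrow> (\<integral>x. 0 \<partial>\<mu>)"
    proof (rule integral_dominated_convergence[where w = "\<lambda>x. (norm (u x *\<^sub>R b))\<^sup>2"])
      show "integrable \<mu> (\<lambda>x. (norm (u x *\<^sub>R b))\<^sup>2)" using seq.prems by (simp add: sq_integrable_def)
      show "(\<lambda>x. (norm (u x *\<^sub>R b - U i x *\<^sub>R b))\<^sup>2) \<in> borel_measurable \<mu>" for i
        using sq_integrable_diff[OF seq.prems sqU[of i]] unfolding sq_integrable_def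
        by (intro borel_measurable_integrable) simp
      show "AE x in \<mu>. norm ((norm (u x *\<^sub>R b - U i x *\<^sub>R b))\<^sup>2) \<le> (norm (u x *\<^sub>R b))\<^sup>2" for i
      proof (rule AE_I2)
        fix x
        have "\<bar>u x - U i x\<bar> \<le> \<bar>u x\<bar>" using le[of i x] seq.hyps(2)[of i x] by simp
        then have "(norm (u x *\<^sub>R b - U i x *\<^sub>R b))\<^sup>2 \<le> (norm (u x *\<^sub>R b))\<^sup>2"
          unfolding scaleR_diff_left[symmetric] norm_scaleR by (intro power_mono mult_right_mono) auto
        then show "norm ((norm (u x *\<^sub>R b - U i x *\<^sub>R b))\<^sup>2) \<le> (norm (u x *\<^sub>R b))\<^sup>2" by simp
      qed
      show "AE x in \<mu>. (\<lambda>i. (norm (u x *\<^sub>R b - U i x *\<^sub>R b))\<^sup>2) \<longlonglongrightarrow> 0"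
      proof (rule AE_I2)
        fix x assume "x \<in> space \<mu>"
        then have "(\<lambda>i. (norm (u x *\<^sub>R b - U i x *\<^sub>R b))\<^sup>2) \<longlonglongrightarrow> (norm (u x *\<^sub>R b - u x *\<^sub>R b))\<^sup>2"
          by (intro tendsto_intros seq.hyps)
        then show "(\<lambda>i. (norm (u x *\<^sub>R b - U i x *\<^sub>R b))\<^sup>2) \<longlonglongrightarrow> 0" by simp
      qed
    qed simp
    then have "(\<lambda>i. L2norm \<mu> (\<lambda>x. u x *\<^sub>R b - U i x *\<^sub>R b)) \<longlonglongrightarrow> 0"
      unfolding L2norm_def by (rule tendsto_real_sqrt[THEN tendsto_eq_rhs]) simp
    then show ?case by (rule C1_approximable_limit[OF seq.prems sqU seq.IH[OF sqU]])
  }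
qed

text \<open>Each coordinate is split into positive and negative parts, both dominated by the
  coordinate and hence square integrable; the rest is linearity.\<close>

lemma C1_maps_dense:
  assumes f: "sq_integrable \<mu> f"
  shows "C1_approximable \<mu> f"
proof -
  have fm[measurable]: "f \<in> borel_measurable \<mu>" by (rule sq_integrable_measurable[OF f])
  have bnd: "sq_integrable \<mu> (\<lambda>x. u x *\<^sub>R b)"
    if "b \<in> Basis" "u \<in> borel_measurable \<mu>" "\<And>x. \<bar>u x\<bar> \<le> \<bar>f x \<bullet> b\<bar>" for u b
  proof (rule sq_integrable_bound)
    show "integrable \<mu> (\<lambda>x. (norm (f x))\<^sup>2)" using f by (simp add: sq_integrable_def)
    show "(norm (u x *\<^sub>R b))\<^sup>2 \<le> (norm (f x))\<^sup>2" for x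
      using that(3)[of x] Basis_le_norm[OF that(1), of "f x"] that(1) by (intro power_mono) auto
  qed (use that in simp)
  have comp: "C1_approximable \<mu> (\<lambda>x. (f x \<bullet> b) *\<^sub>R b)" "sq_integrable \<mu> (\<lambda>x. (f x \<bullet> b) *\<^sub>R b)"
    if b: "b \<in> Basis" for b
  proof -
    have p: "sq_integrable \<mu> (\<lambda>x. max 0 (f x \<bullet> b) *\<^sub>R b)" "sq_integrable \<mu> (\<lambda>x. max 0 (- (f x \<bullet> b)) *\<^sub>R b)"
      by (rule bnd[OF b]; auto)+
    have "C1_approximable \<mu> (\<lambda>x. max 0 (f x \<bullet> b) *\<^sub>R b)" "C1_approximable \<mu> (\<lambda>x. max 0 (- (f x \<bullet> b)) *\<^sub>R b)"
      by (rule C1_approximable_nonneg[OF _ _ b]; use p in auto)+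
    then have "C1_approximable \<mu> (\<lambda>x. max 0 (f x \<bullet> b) *\<^sub>R b + (- 1) *\<^sub>R (max 0 (- (f x \<bullet> b)) *\<^sub>R b))"
      using p by (intro C1_approximable_add C1_approximable_scaleR sq_integrable_scaleR)
    moreover have "max 0 (f x \<bullet> b) *\<^sub>R b + (- 1) *\<^sub>R (max 0 (- (f x \<bullet> b)) *\<^sub>R b) = (f x \<bullet> b) *\<^sub>R b" for x
      by (auto simp: max_def)
    ultimately show "C1_approximable \<mu> (\<lambda>x. (f x \<bullet> b) *\<^sub>R b)" by simp
    show "sq_integrable \<mu> (\<lambda>x. (f x \<bullet> b) *\<^sub>R b)" by (rule bnd[OF b]) auto
  qed
  have "C1_approximable \<mu> (\<lambda>x. \<Sum>b\<in>S. (f x \<bullet> b) *\<^sub>R b) \<and> sq_integrable \<mu> (\<lambda>x. \<Sum>b\<in>S. (f x \<bullet> b) *\<^sub>R b)"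
    if "finite S" "S \<subseteq> Basis" for S
    using that
  proof (induction S rule: finite_induct)
    case empty
    then show ?case using C1_approximable_indicator[of "{}" 0] by (simp add: sq_integrable_def)
  next
    case (insert b S)
    then show ?case using comp[of b] by (simp add: C1_approximable_add sq_integrable_add)
  qed
  from this[OF finite_Basis order_refl] show ?thesis by (simp add: euclidean_representation)
qed

end

section \<open>The Clarke subdifferential\<close>

lemma eventually_W2_nhds:
  "eventually P (W2_nhds \<mu>) \<longleftrightarrow> (\<exists>r>0. \<forall>\<nu>\<in>P2. W2 \<nu> \<mu> < r \<longrightarrow> P \<nu>)"
proof -
  have "eventually P (W2_nhds \<mu>) \<longleftrightarrow> (\<exists>r\<in>{0<..}. eventually P (principal {\<nu> \<in> P2. W2 \<nu> \<mu> < r}))"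
    unfolding W2_nhds_def
  proof (rule eventually_INF_base)
    fix a b :: real assume "a \<in> {0<..}" "b \<in> {0<..}"
    then show "\<exists>x\<in>{0<..}. principal {\<nu> \<in> P2. W2 \<nu> \<mu> < x}
        \<le> inf (principal {\<nu> \<in> P2. W2 \<nu> \<mu> < a}) (principal {\<nu> \<in> P2. W2 \<nu> \<mu> < b})"
      by (intro bexI[of _ "min a b"]) auto
  qed auto
  then show ?thesis by (auto simp: eventually_principal)
qed

text \<open>The pair map \<open>S\<close> pushes \<open>\<nu>\<close> to a coupling of
  \<open>\<nu>'\<close> with \<open>\<nu>\<close> whose displacement is
  \<open>t *\<^sub>R w x\<close> up to sign, at cost exactly
  \<open>t * L2norm \<nu> w\<close>.\<close>

lemma perturbation_P2:
  fixes w :: "'a::euclidean_space \<Rightarrow> 'a"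
  assumes w: "w \<in> C1_maps" and \<nu>: "\<nu> \<in> P2" and "t \<ge> 0"
  defines "\<nu>' \<equiv> distr \<nu> borel (\<lambda>x. x + t *\<^sub>R w x)"
  shows "\<nu>' \<in> P2" "W2 \<nu>' \<nu> \<le> t * L2norm \<nu> w"
proof -
  have wm[measurable]: "w \<in> borel_measurable borel" by (rule C1_maps_measurable[OF w])
  define T where "T x = x + t *\<^sub>R w x" for x
  have Tm[measurable]: "T \<in> borel_measurable borel" unfolding T_def by measurable
  have T\<nu>: "T \<in> \<nu> \<rightarrow>\<^sub>M borel" unfolding P2_D(5)[OF \<nu>] by (rule Tm)
  have \<nu>'_eq: "\<nu>' = distr \<nu> borel T" by (simp add: \<nu>'_def T_def[abs_def])
  have prob: "prob_space \<nu>" by (rule P2_D[OF \<nu>])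
  have sqw: "sq_integrable \<nu> w" by (rule C1_maps_sq_integrable[OF w \<nu>])
  have "sq_integrable \<nu> T"
    unfolding T_def by (intro sq_integrable_add P2_D(4)[OF \<nu>] sq_integrable_scaleR sqw)
  then have "integrable \<nu>' (\<lambda>x. (norm x)\<^sup>2)"
    using sq_integrable_distr[OF T\<nu>, of "\<lambda>x. x"] by (simp add: \<nu>'_eq sq_integrable_def)
  then show "\<nu>' \<in> P2"
    using prob_space.prob_space_distr[OF prob T\<nu>] by (simp add: P2_def \<nu>'_eq)
  define S where "S x = (T x, x)" for x
  have S: "S \<in> \<nu> \<rightarrow>\<^sub>M (borel :: ('a \<times> 'a) measure)"
    unfolding S_def P2_D(5)[OF \<nu>] borel_prod[symmetric] by measurable
  have "distr \<nu> borel (\<lambda>x. x) = distr \<nu> \<nu> (\<lambda>x. x)"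
    by (rule distr_cong) (simp_all add: P2_D[OF \<nu>])
  then have id: "distr \<nu> borel (\<lambda>x. x) = \<nu>" by simp
  have "distr \<nu> borel S \<in> couplings \<nu>' \<nu>"
    using prob_space.prob_space_distr[OF prob S]
    by (simp add: couplings_def distr_distr[OF _ S] \<nu>'_eq) (simp add: S_def comp_def id)
  then have "W2 \<nu>' \<nu> \<le> displacement_norm (distr \<nu> borel S)" by (rule W2_le)
  also have "\<dots> = t * L2norm \<nu> w"
    using \<open>t \<ge> 0\<close>
    by (simp add: displacement_norm_eq_L2norm L2norm_distr[OF S])
      (simp add: S_def T_def L2norm_def power_mult_distrib real_sqrt_mult)
  finally show "W2 \<nu>' \<nu> \<le> t * L2norm \<nu> w" .
qed

text \<open>Difference quotients at a base point \<open>\<nu>'\<close> near \<open>\<nu>\<close> are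
  controlled by the norm of \<open>w\<close> over \<open>\<nu>'\<close>, so this norm must not jump
  up. Minkowski on a coupling of small displacement reduces the claim to the increments of
  \<open>w\<close>.\<close>

lemma L2norm_upper_semicontinuous:
  assumes w: "w \<in> C1_maps" and \<nu>: "\<nu> \<in> P2" and "\<epsilon> > 0"
  shows "\<forall>\<^sub>F \<nu>' in W2_nhds \<nu>. L2norm \<nu>' w \<le> L2norm \<nu> w + \<epsilon>"
proof -
  obtain \<delta> where \<delta>: "\<delta> > 0"
    "\<And>\<nu>' \<gamma>. \<nu>' \<in> P2 \<Longrightarrow> \<gamma> \<in> couplings \<nu> \<nu>' \<Longrightarrow> displacement_norm \<gamma> < \<delta> \<Longrightarrow>
      L2norm \<gamma> (\<lambda>z. w (snd z) - w (fst z)) \<le> \<epsilon>"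
    using C1_maps_increment_small[OF w \<nu> \<open>\<epsilon> > 0\<close>] by metis
  have "L2norm \<nu>' w \<le> L2norm \<nu> w + \<epsilon>" if \<nu>': "\<nu>' \<in> P2" "W2 \<nu>' \<nu> < \<delta>" for \<nu>'
  proof -
    obtain \<gamma> where \<gamma>: "\<gamma> \<in> couplings \<nu> \<nu>'" "displacement_norm \<gamma> < \<delta>"
      using W2_lessE[OF \<nu> \<nu>'(1)] \<nu>'(2) W2_commute[OF \<nu> \<nu>'(1)] by metis
    note tr = couplings_transfer[OF \<gamma>(1) C1_maps_measurable[OF w]]
    have sq: "sq_integrable \<gamma> (\<lambda>z. w (fst z))" "sq_integrable \<gamma> (\<lambda>z. w (snd z))"
      using tr C1_maps_sq_integrable[OF w] \<nu> \<nu>' by simp_all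
    have "L2norm \<nu>' w = L2norm \<gamma> (\<lambda>z. w (fst z) + (w (snd z) - w (fst z)))"
      by (simp add: tr(4))
    also have "\<dots> \<le> L2norm \<gamma> (\<lambda>z. w (fst z)) + L2norm \<gamma> (\<lambda>z. w (snd z) - w (fst z))"
      by (intro L2norm_add_le sq_integrable_diff sq)
    also have "\<dots> \<le> L2norm \<nu> w + \<epsilon>"
      using \<delta>(2)[OF \<nu>'(1) \<gamma>] by (simp add: tr(3))
    finally show ?thesis .
  qed
  with \<delta>(1) show ?thesis unfolding eventually_W2_nhds by blast
qed

lemma eventually_W2_ball:
  assumes \<mu>: "\<mu> \<in> P2" and \<nu>: "\<nu> \<in> P2" "W2 \<nu> \<mu> < r"
  shows "\<forall>\<^sub>F \<nu>' in W2_nhds \<nu>. \<nu>' \<in> P2 \<and> W2 \<nu>' \<mu> < r"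
  unfolding eventually_W2_nhds
proof (intro exI[of _ "r - W2 \<nu> \<mu>"] conjI ballI impI)
  fix \<nu>' assume "\<nu>' \<in> P2" "W2 \<nu>' \<nu> < r - W2 \<nu> \<mu>"
  then show "\<nu>' \<in> P2" "W2 \<nu>' \<mu> < r" using W2_triangle[of \<nu>' \<nu> \<mu>] \<mu> \<nu> by auto
qed (use \<nu> in simp)

text \<open>The quotient at \<open>\<nu>'\<close> is at most \<open>L\<close> times the norm of
  \<open>w\<close> over \<open>\<nu>'\<close>, provided the perturbed measure stays in the Lipschitz
  ball; letting \<open>\<nu>'\<close> approach \<open>\<nu>\<close> costs an arbitrarily small
  \<open>\<epsilon>\<close>.\<close>

lemma clarke_derivative_le_lipschitz:
  assumes \<mu>: "\<mu> \<in> P2" and "L \<ge> 0"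
    and lip: "\<And>\<nu>1 \<nu>2. \<nu>1 \<in> P2 \<Longrightarrow> \<nu>2 \<in> P2 \<Longrightarrow> W2 \<nu>1 \<mu> < r \<Longrightarrow> W2 \<nu>2 \<mu> < r \<Longrightarrow>
      \<bar>G \<nu>1 - G \<nu>2\<bar> \<le> L * W2 \<nu>1 \<nu>2"
    and \<nu>: "\<nu> \<in> P2" "W2 \<nu> \<mu> < r" and w: "w \<in> C1_maps"
  shows "clarke_derivative G \<nu> w \<le> ereal (L * L2norm \<nu> w)"
proof -
  define N where "N = L2norm \<nu> w"
  have N: "N \<ge> 0" by (simp add: N_def L2norm_nonneg)
  have bound: "clarke_derivative G \<nu> w \<le> ereal (L * (N + \<epsilon>))" if "\<epsilon> > 0" for \<epsilon>
  proof -
    \<comment> \<open>An intermediate radius: base points stay within \<open>s\<close> of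
      \<open>\<mu>\<close>, and \<open>t < \<tau>\<close> keeps the displacement bound
      \<open>t * (N + \<epsilon>)\<close> below the margin \<open>r - s\<close>.\<close>
    define s where "s = (r + W2 \<nu> \<mu>) / 2"
    have s: "W2 \<nu> \<mu> < s" "s < r" using \<nu>(2) by (simp_all add: s_def)
    define \<tau> where "\<tau> = (r - s) / (N + \<epsilon>)"
    have \<tau>: "\<tau> > 0" using s N \<open>\<epsilon> > 0\<close> by (simp add: \<tau>_def)
    have quot: "(G (distr \<nu>' borel (\<lambda>x. x + t *\<^sub>R w x)) - G \<nu>') / t \<le> L * (N + \<epsilon>)"
      if \<nu>': "\<nu>' \<in> P2" "W2 \<nu>' \<mu> < s" "L2norm \<nu>' w \<le> N + \<epsilon>" and t: "0 < t" "t < \<tau>" for \<nu>' t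
    proof -
      define \<nu>'' where "\<nu>'' = distr \<nu>' borel (\<lambda>x. x + t *\<^sub>R w x)"
      have \<nu>'': "\<nu>'' \<in> P2" "W2 \<nu>'' \<nu>' \<le> t * L2norm \<nu>' w"
        using perturbation_P2[OF w \<nu>'(1), of t] t by (simp_all add: \<nu>''_def)
      have le: "W2 \<nu>'' \<nu>' \<le> t * (N + \<epsilon>)"
        using \<nu>''(2) mult_left_mono[OF \<nu>'(3), of t] t by linarith
      also have "\<dots> < r - s" using t N \<open>\<epsilon> > 0\<close> by (simp add: \<tau>_def pos_less_divide_eq)
      finally have "W2 \<nu>'' \<mu> < r" using W2_triangle[OF \<nu>''(1) \<nu>'(1) \<mu>] \<nu>'(2) by linarith
      then have "\<bar>G \<nu>'' - G \<nu>'\<bar> \<le> L * W2 \<nu>'' \<nu>'" using \<nu>' s by (intro lip \<nu>''(1)) auto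
      also have "\<dots> \<le> L * (t * (N + \<epsilon>))" using le \<open>L \<ge> 0\<close> by (rule mult_left_mono)
      finally show ?thesis using t by (simp add: \<nu>''_def[symmetric] pos_divide_le_eq algebra_simps)
    qed
    have "\<forall>\<^sub>F \<nu>' in W2_nhds \<nu>. (\<nu>' \<in> P2 \<and> W2 \<nu>' \<mu> < s) \<and> L2norm \<nu>' w \<le> N + \<epsilon>"
      unfolding N_def using eventually_W2_ball[OF \<mu> \<nu>(1) s(1)] L2norm_upper_semicontinuous[OF w \<nu>(1) that]
      by (rule eventually_conj)
    moreover have "\<forall>\<^sub>F t in at_right 0. 0 < t \<and> t < \<tau>"
      unfolding eventually_at_right_field using \<tau> by (intro exI[of _ \<tau>]) simp
    ultimately have "\<forall>\<^sub>F p in W2_nhds \<nu> \<times>\<^sub>F at_right 0.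
        ((fst p \<in> P2 \<and> W2 (fst p) \<mu> < s) \<and> L2norm (fst p) w \<le> N + \<epsilon>) \<and> 0 < snd p \<and> snd p < \<tau>"
      by (rule eventually_prodI)
    then have "\<forall>\<^sub>F (\<nu>', t) in W2_nhds \<nu> \<times>\<^sub>F at_right 0.
        (G (distr \<nu>' borel (\<lambda>x. x + t *\<^sub>R w x)) - G \<nu>') / t \<le> L * (N + \<epsilon>)"
      by eventually_elim (simp add: case_prod_unfold quot)
    then show ?thesis
      unfolding clarke_derivative_def by (intro Limsup_bounded) (simp add: case_prod_unfold)
  qed
  show ?thesis
  proof (rule ereal_le_epsilon2)
    fix e :: real assume "e > 0"
    \<comment> \<open>Dividing by \<open>L + 1\<close> instead of \<open>L\<close> also covers
      \<open>L = 0\<close>.\<close>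
    then have e: "e / (L + 1) > 0" using \<open>L \<ge> 0\<close> by simp
    have "L * (N + e / (L + 1)) \<le> L * N + e"
      using \<open>L \<ge> 0\<close> \<open>e > 0\<close> by (simp add: field_simps)
    then show "clarke_derivative G \<nu> w \<le> ereal (L * L2norm \<nu> w) + ereal e"
      using order_trans[OF bound[OF e], of "ereal (L * N + e)"] by (simp add: N_def)
  qed
qed

text \<open>Were \<open>\<Xi>\<close> itself an admissible direction, the subgradient inequality
  would read \<open>N\<^sup>2 \<le> L * N\<close>. An approximating \<open>w\<close> replaces it,
  with an error linear in the approximation \<open>\<epsilon>\<close>.\<close>

lemma clarke_subgradient_norm_le:
  assumes \<nu>: "\<nu> \<in> P2" and "L \<ge> 0"
    and bound: "\<And>w. w \<in> C1_maps \<Longrightarrow> clarke_derivative G \<nu> w \<le> ereal (L * L2norm \<nu> w)"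
    and \<Xi>: "\<Xi> \<in> clarke_subdifferential G \<nu>"
  shows "L2norm \<nu> \<Xi> \<le> L"
proof -
  define N where "N = L2norm \<nu> \<Xi>"
  have N: "N \<ge> 0" by (simp add: N_def L2norm_nonneg)
  have sq: "sq_integrable \<nu> \<Xi>" using \<Xi> by (simp add: clarke_subdifferential_def L2_iff_sq_integrable)
  have "N\<^sup>2 \<le> L * N + e" if "e > 0" for e
  proof -
    \<comment> \<open>The total error will be \<open>(L + N) * \<epsilon>\<close>:
      \<open>L * \<epsilon>\<close> from the norm of \<open>w\<close> and
      \<open>N * \<epsilon>\<close> from the pairing with the remainder
      \<open>\<Xi> x - w x\<close>.\<close>
    define \<epsilon> where "\<epsilon> = e / (L + N + 1)"
    have \<epsilon>: "\<epsilon> > 0" using that \<open>L \<ge> 0\<close> N by (simp add: \<epsilon>_def)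
    obtain w where w: "w \<in> C1_maps" "L2norm \<nu> (\<lambda>x. \<Xi> x - w x) < \<epsilon>"
      using C1_maps_dense[OF \<nu> sq] \<epsilon> unfolding C1_approximable_def by blast
    have sqw: "sq_integrable \<nu> w" by (rule C1_maps_sq_integrable[OF w(1) \<nu>])
    have "ereal (L2_inner \<nu> \<Xi> w) \<le> clarke_derivative G \<nu> w"
      using \<Xi> w(1) by (simp add: clarke_subdifferential_def)
    also have "\<dots> \<le> ereal (L * L2norm \<nu> w)" by (rule bound[OF w(1)])
    finally have "ereal (L2_inner \<nu> \<Xi> w) \<le> ereal (L * L2norm \<nu> w)" .
    then have 1: "(\<integral>x. \<Xi> x \<bullet> w x \<partial>\<nu>) \<le> L * L2norm \<nu> w" by (simp add: L2_inner_def)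
    have "L2norm \<nu> w = L2norm \<nu> (\<lambda>x. \<Xi> x + (w x - \<Xi> x))" by simp
    also have "\<dots> \<le> N + L2norm \<nu> (\<lambda>x. w x - \<Xi> x)"
      unfolding N_def by (intro L2norm_add_le sq sq_integrable_diff sqw)
    also have "L2norm \<nu> (\<lambda>x. w x - \<Xi> x) = L2norm \<nu> (\<lambda>x. \<Xi> x - w x)"
      by (simp add: L2norm_def norm_minus_commute)
    finally have "L2norm \<nu> w \<le> N + \<epsilon>" using w(2) by simp
    then have 2: "L * L2norm \<nu> w \<le> L * (N + \<epsilon>)" using \<open>L \<ge> 0\<close> by (rule mult_left_mono)
    have 3: "(\<integral>x. \<Xi> x \<bullet> (\<Xi> x - w x) \<partial>\<nu>) \<le> N * \<epsilon>"
    proof -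
      have "(\<integral>x. \<Xi> x \<bullet> (\<Xi> x - w x) \<partial>\<nu>) \<le> N * L2norm \<nu> (\<lambda>x. \<Xi> x - w x)"
        using L2_Cauchy_Schwarz[OF sq sq_integrable_diff[OF sq sqw]] by (simp add: N_def abs_le_iff)
      also have "\<dots> \<le> N * \<epsilon>" using w(2) N by (intro mult_left_mono) auto
      finally show ?thesis .
    qed
    have "N\<^sup>2 = (\<integral>x. \<Xi> x \<bullet> w x + \<Xi> x \<bullet> (\<Xi> x - w x) \<partial>\<nu>)"
      by (simp add: N_def L2norm_power2 power2_norm_eq_inner inner_diff_right)
    also have "\<dots> = (\<integral>x. \<Xi> x \<bullet> w x \<partial>\<nu>) + (\<integral>x. \<Xi> x \<bullet> (\<Xi> x - w x) \<partial>\<nu>)"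
      by (intro Bochner_Integration.integral_add sq_integrable_inner sq_integrable_diff sq sqw)
    also have "\<dots> \<le> L * (N + \<epsilon>) + N * \<epsilon>" using 1 2 3 by linarith
    also have "\<dots> = L * N + (L + N) * \<epsilon>" by (simp add: algebra_simps)
    also have "(L + N) * \<epsilon> \<le> e"
      using that \<open>L \<ge> 0\<close> N by (simp add: \<epsilon>_def field_simps)
    finally show ?thesis by simp
  qed
  then have "N\<^sup>2 \<le> L * N" by (rule field_le_epsilon)
  then show ?thesis using N \<open>L \<ge> 0\<close> by (cases "N = 0") (auto simp: power2_eq_square N_def[symmetric])
qed

lemma clarke_derivative_upper_semicontinuous:
  assumes \<mu>: "\<mu> \<in> P2" and less: "clarke_derivative G \<mu> w < ereal c"
  shows "\<forall>\<^sub>F \<nu> in W2_nhds \<mu>. clarke_derivative G \<nu> w \<le> ereal c"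
proof -
  have "\<forall>\<^sub>F p in W2_nhds \<mu> \<times>\<^sub>F at_right 0.
      (case p of (\<nu>, t) \<Rightarrow> ereal ((G (distr \<nu> borel (\<lambda>x. x + t *\<^sub>R w x)) - G \<nu>) / t)) < ereal c"
    using less unfolding clarke_derivative_def by (rule Limsup_lessD)
  \<comment> \<open>A product neighbourhood: only \<open>P\<close> has to be transported to the new
    base point; \<open>Q\<close>, on the times \<open>t\<close>, stays the same.\<close>
  then obtain P Q where P: "eventually P (W2_nhds \<mu>)" and Q: "eventually Q (at_right 0)"
    and PQ: "\<And>\<nu> t. P \<nu> \<Longrightarrow> Q t \<Longrightarrow> (G (distr \<nu> borel (\<lambda>x. x + t *\<^sub>R w x)) - G \<nu>) / t < c"
    unfolding eventually_prod_filter by auto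
  obtain r where r: "r > 0" "\<And>\<nu>. \<nu> \<in> P2 \<Longrightarrow> W2 \<nu> \<mu> < r \<Longrightarrow> P \<nu>"
    using P unfolding eventually_W2_nhds by auto
  have "clarke_derivative G \<nu> w \<le> ereal c" if \<nu>: "\<nu> \<in> P2" "W2 \<nu> \<mu> < r" for \<nu>
    unfolding clarke_derivative_def
  proof (rule Limsup_bounded)
    have "eventually P (W2_nhds \<nu>)"
      using eventually_W2_ball[OF \<mu> \<nu>] by eventually_elim (simp add: r(2))
    then show "\<forall>\<^sub>F p in W2_nhds \<nu> \<times>\<^sub>F at_right 0.
      (case p of (\<nu>, t) \<Rightarrow> ereal ((G (distr \<nu> borel (\<lambda>x. x + t *\<^sub>R w x)) - G \<nu>) / t)) \<le> ereal c"
      unfolding eventually_prod_filter using Q PQ by (intro exI[of _ P] exI[of _ Q]) (auto intro: less_imp_le)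
  qed
  then show ?thesis unfolding eventually_W2_nhds using r(1) by blast
qed

section \<open>Passage to the limit\<close>

text \<open>Both pairings are integrals over the same \<open>\<gamma>\<close>, of
  \<open>\<Xi> y \<bullet> w x\<close> and of \<open>\<Xi> y \<bullet> w y\<close>. Their difference
  pairs \<open>\<Xi> y\<close> with the increment of \<open>w\<close>, and \<open>\<Xi> y\<close>
  has the same norm over \<open>\<gamma>\<close> as over \<open>\<nu>\<close>.\<close>

lemma L2_inner_pullback_diff_le:
  fixes \<mu> \<nu> :: "'a::euclidean_space measure"
  assumes \<mu>: "\<mu> \<in> P2" and \<nu>: "\<nu> \<in> P2" and \<gamma>: "\<gamma> \<in> couplings \<mu> \<nu>"
    and \<Xi>: "\<Xi> \<in> L2 \<nu>" and w: "w \<in> C1_maps"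
  shows "\<bar>L2_inner \<mu> (pullback \<gamma> \<Xi>) w - L2_inner \<nu> \<Xi> w\<bar>
    \<le> L2norm \<nu> \<Xi> * L2norm \<gamma> (\<lambda>z. w (snd z) - w (fst z))"
proof -
  note c = couplings_D[OF \<gamma>]
  interpret prob_space \<gamma> by (rule c)
  have \<Xi>m[measurable]: "\<Xi> \<in> borel_measurable borel"
    using \<Xi> unfolding L2_def P2_D(5)[OF \<nu>] by simp
  have wm[measurable]: "w \<in> borel_measurable borel" by (rule C1_maps_measurable[OF w])
  have sq: "sq_integrable \<gamma> (\<lambda>z. \<Xi> (snd z))" "sq_integrable \<gamma> (\<lambda>z. w (fst z))" "sq_integrable \<gamma> (\<lambda>z. w (snd z))"
    using couplings_transfer[OF \<gamma> \<Xi>m] couplings_transfer[OF \<gamma> wm] \<Xi> C1_maps_sq_integrable[OF w] \<mu> \<nu>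
    by (simp_all add: L2_iff_sq_integrable)
  have int: "integrable \<gamma> (\<lambda>z. \<Xi> (snd z))"
  proof (rule Bochner_Integration.integrable_bound)
    show "integrable \<gamma> (\<lambda>z. 1 + (norm (\<Xi> (snd z)))\<^sup>2)" using sq(1) by (simp add: sq_integrable_def)
    have "norm a \<le> 1 + (norm a)\<^sup>2" for a :: 'a
    proof -
      have "2 * norm a \<le> 1 + (norm a)\<^sup>2"
        using zero_le_power2[of "norm a - 1"] by (simp add: power2_diff)
      then show ?thesis using norm_ge_zero[of a] by linarith
    qed
    then show "AE z in \<gamma>. norm (\<Xi> (snd z)) \<le> norm (1 + (norm (\<Xi> (snd z)))\<^sup>2)" by simp
  qed (rule sq_integrable_measurable[OF sq(1)])
  have "L2_inner \<mu> (pullback \<gamma> \<Xi>) w = (\<integral>z. \<Xi> (snd z) \<bullet> w (fst z) \<partial>\<gamma>)"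
    using L2_inner_pullback[OF c(1,2) \<Xi>m wm int sq_integrable_inner[OF sq(1,2)]] by (simp add: c(3))
  moreover have "L2_inner \<nu> \<Xi> w = (\<integral>z. \<Xi> (snd z) \<bullet> w (snd z) \<partial>\<gamma>)"
    unfolding L2_inner_def c(4)[symmetric] by (rule integral_distr) (simp_all add: c(6))
  ultimately have "L2_inner \<nu> \<Xi> w - L2_inner \<mu> (pullback \<gamma> \<Xi>) w
      = (\<integral>z. \<Xi> (snd z) \<bullet> (w (snd z) - w (fst z)) \<partial>\<gamma>)"
    using sq_integrable_inner[OF sq(1,2)] sq_integrable_inner[OF sq(1,3)] by (simp add: inner_diff_right)
  then show ?thesis
    using L2_Cauchy_Schwarz[OF sq(1) sq_integrable_diff[OF sq(3,2)]] couplings_transfer(4)[OF \<gamma> \<Xi>m]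
    by (simp add: abs_minus_commute)
qed

text \<open>The subbasic neighbourhood of \<open>\<Xi>\<close> given by the single test map
  \<open>g\<close> is enough; around a cluster point the sequence visits it infinitely often, though
  perhaps not for all large \<open>n\<close>.\<close>

lemma frequently_weak_limit_point:
  assumes lim: "seq_limit_point_in (L2_weak_topology \<mu>) x \<Xi>" and "\<Xi> \<in> L2 \<mu>" "g \<in> L2 \<mu>" "e > 0"
  shows "\<exists>\<^sub>F n in sequentially. \<bar>L2_inner \<mu> (x n) g - L2_inner \<mu> \<Xi> g\<bar> < e"
proof -
  define U where "U = {f \<in> L2 \<mu>. L2_inner \<mu> f g \<in> ball (L2_inner \<mu> \<Xi> g) e}"
  have "openin (L2_weak_topology \<mu>) U"
    unfolding L2_weak_topology_def U_def using assms(3)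
    by (intro topology_generated_by_Basis) blast
  moreover have "\<Xi> \<in> U" using assms by (simp add: U_def)
  ultimately have "\<exists>\<^sub>F n in sequentially. x n \<in> U" using lim by (auto simp: seq_limit_point_in_def)
  then show ?thesis
    by (rule frequently_elim1) (simp add: U_def dist_real_def abs_minus_commute)
qed

text \<open>The subgradient hypothesis is eventual because the subdifferential at
  \<open>\<mu>s n\<close> is only meant for \<open>\<mu>s n\<close> in the region where
  \<open>G\<close> is Lipschitz. Square integrability is asked of every \<open>\<Xi>s n\<close> so
  that the whole sequence of pullbacks makes sense.\<close>

theorem proposition4p5:
  fixes G :: "'a::euclidean_space measure \<Rightarrow> real"
    and \<mu> :: "'a measure" and \<mu>s :: "nat \<Rightarrow> 'a measure"
    and \<Xi> :: "'a \<Rightarrow> 'a" and \<Xi>s :: "nat \<Rightarrow> 'a \<Rightarrow> 'a"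
    and \<gamma>s :: "nat \<Rightarrow> ('a \<times> 'a) measure"
  assumes "\<mu> \<in> P2"
    and "locally_lipschitz_around G \<mu>"
    and "\<And>n. \<mu>s n \<in> P2"
    and "(\<lambda>n. W2 (\<mu>s n) \<mu>) \<longlonglongrightarrow> 0"
    and "\<And>n. \<Xi>s n \<in> L2 (\<mu>s n)"
    and "\<forall>\<^sub>F n in sequentially. \<Xi>s n \<in> clarke_subdifferential G (\<mu>s n)"
    and "\<And>n. \<gamma>s n \<in> couplings \<mu> (\<mu>s n)"
    and "(\<lambda>n. displacement_norm (\<gamma>s n)) \<longlonglongrightarrow> 0"
    and "\<Xi> \<in> L2 \<mu>"
    and "seq_limit_point_in (L2_weak_topology \<mu>) (\<lambda>n. pullback (\<gamma>s n) (\<Xi>s n)) \<Xi>"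
  shows "\<Xi> \<in> clarke_subdifferential G \<mu>"
proof -
  note \<mu> = assms(1) and \<mu>s = assms(3)
  obtain r L0 where r: "r > 0" and lip0: "\<And>\<nu>1 \<nu>2. \<nu>1 \<in> P2 \<Longrightarrow> \<nu>2 \<in> P2 \<Longrightarrow> W2 \<nu>1 \<mu> < r \<Longrightarrow> W2 \<nu>2 \<mu> < r \<Longrightarrow>
      \<bar>G \<nu>1 - G \<nu>2\<bar> \<le> L0 * W2 \<nu>1 \<nu>2"
    using assms(2) unfolding locally_lipschitz_around_def by auto
  \<comment> \<open>The given constant may be negative, while the estimates multiply inequalities by
    it.\<close>
  define L where "L = max L0 0"
  have L: "L \<ge> 0" by (simp add: L_def)
  have lip: "\<bar>G \<nu>1 - G \<nu>2\<bar> \<le> L * W2 \<nu>1 \<nu>2"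
    if "\<nu>1 \<in> P2" "\<nu>2 \<in> P2" "W2 \<nu>1 \<mu> < r" "W2 \<nu>2 \<mu> < r" for \<nu>1 \<nu>2
  proof -
    have "L0 * W2 \<nu>1 \<nu>2 \<le> L * W2 \<nu>1 \<nu>2"
      using W2_nonneg[OF that(1,2)] by (intro mult_right_mono) (simp_all add: L_def)
    with lip0[OF that] show ?thesis by linarith
  qed
  have near: "\<forall>\<^sub>F n in sequentially. P (\<mu>s n)" if ev: "eventually P (W2_nhds \<mu>)" for P
  proof -
    obtain s where s: "s > 0" "\<And>\<nu>. \<nu> \<in> P2 \<Longrightarrow> W2 \<nu> \<mu> < s \<Longrightarrow> P \<nu>"
      using ev unfolding eventually_W2_nhds by auto
    show ?thesis using order_tendstoD(2)[OF assms(4) s(1)] by eventually_elim (rule s(2)[OF \<mu>s])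
  qed
  have norm_le: "\<forall>\<^sub>F n in sequentially. L2norm (\<mu>s n) (\<Xi>s n) \<le> L"
    using order_tendstoD(2)[OF assms(4) r] assms(6)
  proof eventually_elim
    case (elim n)
    show ?case
      by (rule clarke_subgradient_norm_le[OF \<mu>s L _ elim(2)])
        (rule clarke_derivative_le_lipschitz[OF \<mu> L lip \<mu>s elim(1)])
  qed
  have "ereal (L2_inner \<mu> \<Xi> w) \<le> clarke_derivative G \<mu> w" if w: "w \<in> C1_maps" for w
  proof (rule ccontr)
    assume "\<not> ?thesis"
    \<comment> \<open>A real number strictly in between: the Clarke derivative is an extended real
      that could be -\<infinity>, and upper semicontinuity starts from a strict inequality.\<close>
    then obtain c where c: "clarke_derivative G \<mu> w < ereal c" "c < L2_inner \<mu> \<Xi> w"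
      using ereal_dense2[of "clarke_derivative G \<mu> w" "ereal (L2_inner \<mu> \<Xi> w)"] by (auto simp: not_le)
    define a where "a = L2_inner \<mu> \<Xi> w - c"
    have a: "a > 0" using c by (simp add: a_def)
    \<comment> \<open>The gap \<open>a\<close> is split in two:
      \<open>L * \<epsilon> \<le> a / 2\<close> pays for exchanging the pairing over
      \<open>\<mu>\<close> with the one over \<open>\<mu>s n\<close>, the other half for the weak
      approximation.\<close>
    define \<epsilon> where "\<epsilon> = a / (2 * (L + 1))"
    have \<epsilon>: "\<epsilon> > 0" using a L by (simp add: \<epsilon>_def)
    obtain \<delta> where \<delta>: "\<delta> > 0"
      "\<And>\<nu> \<gamma>. \<nu> \<in> P2 \<Longrightarrow> \<gamma> \<in> couplings \<mu> \<nu> \<Longrightarrow> displacement_norm \<gamma> < \<delta> \<Longrightarrow>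
        L2norm \<gamma> (\<lambda>z. w (snd z) - w (fst z)) \<le> \<epsilon>"
      using C1_maps_increment_small[OF w \<mu> \<epsilon>] by metis
    have freq: "\<exists>\<^sub>F n in sequentially. \<bar>L2_inner \<mu> (pullback (\<gamma>s n) (\<Xi>s n)) w - L2_inner \<mu> \<Xi> w\<bar> < a / 2"
      using C1_maps_sq_integrable[OF w \<mu>] a
      by (intro frequently_weak_limit_point[OF assms(10,9)]) (simp_all add: L2_iff_sq_integrable)
    have ev: "\<forall>\<^sub>F n in sequentially. L2_inner \<mu> (pullback (\<gamma>s n) (\<Xi>s n)) w \<le> c + a / 2"
      using norm_le order_tendstoD(2)[OF assms(8) \<delta>(1)] assms(6)
        near[OF clarke_derivative_upper_semicontinuous[OF \<mu> c(1)]]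
    proof eventually_elim
      case (elim n)
      have "ereal (L2_inner (\<mu>s n) (\<Xi>s n) w) \<le> clarke_derivative G (\<mu>s n) w"
        using elim(3) w by (simp add: clarke_subdifferential_def)
      also note elim(4)
      finally have "ereal (L2_inner (\<mu>s n) (\<Xi>s n) w) \<le> ereal c" .
      then have 1: "L2_inner (\<mu>s n) (\<Xi>s n) w \<le> c" by simp
      have "L2norm (\<mu>s n) (\<Xi>s n) * L2norm (\<gamma>s n) (\<lambda>z. w (snd z) - w (fst z)) \<le> L * \<epsilon>"
        by (intro mult_mono elim(1) \<delta>(2)[OF \<mu>s assms(7) elim(2)] L L2norm_nonneg)
      also have "\<dots> \<le> a / 2" using L a by (simp add: \<epsilon>_def field_simps)
      finally show ?case
        using L2_inner_pullback_diff_le[OF \<mu> \<mu>s assms(7) assms(5) w, of n] 1 by linarith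
    qed
    \<comment> \<open>An event that happens infinitely often meets one that holds eventually; at a
      common \<open>n\<close> the strict and the non-strict bound contradict each other.\<close>
    obtain n where n: "\<bar>L2_inner \<mu> (pullback (\<gamma>s n) (\<Xi>s n)) w - L2_inner \<mu> \<Xi> w\<bar> < a / 2"
        "L2_inner \<mu> (pullback (\<gamma>s n) (\<Xi>s n)) w \<le> c + a / 2"
      using frequently_ex[OF frequently_eventually_frequently[OF freq ev]] by auto
    have "L2_inner \<mu> \<Xi> w - L2_inner \<mu> (pullback (\<gamma>s n) (\<Xi>s n)) w < a / 2" using n(1) by linarith
    moreover have "L2_inner \<mu> \<Xi> w = c + a / 2 + a / 2" by (simp add: a_def)
    ultimately show False using n(2) by linarith
  qed
  with assms(9) show ?thesis by (simp add: clarke_subdifferential_def)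
qed

end
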